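(* Let $(X,d,\mu)$ be a metric measure space all of whose porous subsets have $\mu$-measure zero, and let $(U,\varphi)$ be a rectifiable chart in $X$. Let $(Y,d_Y)$ be a metric space and let $f:X\to Y$ be any mapping. Then $f$ is metrically differentiable with respect to $(U,\varphi)$ at $\mu$-almost every point of $U\cap S(f)$.
   Context: A metric measure space $(X,d,\mu)$ is a complete separable metric space $(X,d)$ endowed with a Borel regular (outer) measure $\mu$ that is finite on bounded sets. Porous sets: a set $S\subset X$ is $\eta$-porous at $x\in S$, for $\eta>0$, if there is a sequence $x_j\to x$ in $X$, $x_j\neq x$, with $d(x_j,S):=\inf\{d(x_j,y):y\in S\}\ge \eta\, d(x_j,x)$ for all $j\in\mathbb{N}$. $S$ is porous if for every $x\in S$ there is $\eta>0$ (possibly depending on $x$) such that $S$ is $\eta$-porous at $x$. Charts: an $n$-dimensional chart $(U,\varphi)$ in $X$ consists of a Borel set $U\subset X$ and a Lipschitz map $\varphi:X\to\mathbb{R}^n$. It is a rectifiable ($n$-rectifiable) chart if $\varphi$ is bi-Lipschitz on $U$ (i.e. $\varphi|_U:U\to\varphi(U)$ is bi-Lipschitz) and $\varphi_\#(\mu|_U)\ll \mathcal{L}^n|_{\varphi(U)}$, where $\mathcal{L}^n$ is Lebesgue measure and $\varphi_\#$ denotes push-forward. Pointwise Lipschitz set: for $f:X\to Y$, $\operatorname{Lip} f(x):=\limsup_{y\to x}\frac{d_Y(f(x),f(y))}{d(x,y)}$ (and $\operatorname{Lip}f(x)=0$ if $x$ is isolated), and $S(f):=\{x\in X:\operatorname{Lip}f(x)<\infty\}$.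 Metric differentiability: $f:X\to Y$ is metrically differentiable at $x\in U$ with respect to an $n$-dimensional chart $(U,\varphi)$ if there exists a seminorm $\operatorname{md}_xf$ on $\mathbb{R}^n$ such that $$\limsup_{X\ni y\to x}\frac{|d_Y(f(x),f(y))-\operatorname{md}_xf(\varphi(x)-\varphi(y))|}{d(x,y)}=0,$$ where $y$ ranges over all of $X$ (the condition is vacuous if $x$ is isolated in $X$). *)

theory Defs
  imports "HOL-Analysis.Analysis"
begin

text \<open>
  Measures are outer measures, i.e. functions on all subsets of the space, so that null sets need
  not be Borel. The class \<open>polish_space\<close> carries a fixed complete separable metric; together with
  the following predicate it models a metric measure space.
\<close>

definition metric_measure :: "('a::polish_space set \<Rightarrow> ennreal) \<Rightarrow> bool" where
  "metric_measure \<mu> \<longleftrightarrow>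
     outer_measure_space (Pow UNIV) \<mu> \<and>
     sets borel \<subseteq> lambda_system UNIV (Pow UNIV) \<mu> \<and>
     (\<forall>A. \<exists>B\<in>sets borel. A \<subseteq> B \<and> \<mu> B = \<mu> A) \<and>
     (\<forall>A. bounded A \<longrightarrow> \<mu> A < \<infinity>)"

definition porous_at :: "real \<Rightarrow> 'a::metric_space set \<Rightarrow> 'a \<Rightarrow> bool" where
  "porous_at \<eta> S x \<longleftrightarrow>
     x \<in> S \<and>
     (\<exists>X. X \<longlonglongrightarrow> x \<and> (\<forall>j::nat. X j \<noteq> x \<and> infdist (X j) S \<ge> \<eta> * dist (X j) x))"

definition porous :: "'a::metric_space set \<Rightarrow> bool" where
  "porous S \<longleftrightarrow> (\<forall>x\<in>S. \<exists>\<eta>>0. porous_at \<eta> S x)"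

definition bi_lipschitz_on :: "'a::metric_space set \<Rightarrow> ('a \<Rightarrow> 'b::metric_space) \<Rightarrow> bool" where
  "bi_lipschitz_on U \<phi> \<longleftrightarrow>
     (\<exists>c>0. \<exists>C. \<forall>x\<in>U. \<forall>y\<in>U.
        c * dist x y \<le> dist (\<phi> x) (\<phi> y) \<and> dist (\<phi> x) (\<phi> y) \<le> C * dist x y)"

definition restrict_outer :: "('a set \<Rightarrow> ennreal) \<Rightarrow> 'a set \<Rightarrow> 'a set \<Rightarrow> ennreal" where
  "restrict_outer \<mu> U A = \<mu> (A \<inter> U)"

definition push_outer :: "('a \<Rightarrow> 'b) \<Rightarrow> ('a set \<Rightarrow> ennreal) \<Rightarrow> 'b set \<Rightarrow> ennreal" where
  "push_outer \<phi> \<mu> A = \<mu> (\<phi> -` A)"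

definition abs_cont_outer :: "('a set \<Rightarrow> ennreal) \<Rightarrow> ('a set \<Rightarrow> ennreal) \<Rightarrow> bool" where
  "abs_cont_outer \<nu> \<mu> \<longleftrightarrow> (\<forall>A. \<mu> A = 0 \<longrightarrow> \<nu> A = 0)"

definition chart :: "'a::metric_space set \<Rightarrow> ('a \<Rightarrow> real ^ 'n) \<Rightarrow> bool" where
  "chart U \<phi> \<longleftrightarrow> U \<in> sets borel \<and> (\<exists>C. C-lipschitz_on UNIV \<phi>)"

definition rectifiable_chart ::
    "('a::metric_space set \<Rightarrow> ennreal) \<Rightarrow> 'a set \<Rightarrow> ('a \<Rightarrow> real ^ 'n) \<Rightarrow> bool" where
  "rectifiable_chart \<mu> U \<phi> \<longleftrightarrow>
     chart U \<phi> \<and> bi_lipschitz_on U \<phi> \<and>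
     abs_cont_outer (push_outer \<phi> (restrict_outer \<mu> U))
                    (restrict_outer (outer_measure_of lborel) (\<phi> ` U))"

definition Lip :: "('a::metric_space \<Rightarrow> 'b::metric_space) \<Rightarrow> 'a \<Rightarrow> ennreal" where
  "Lip f x =
     (if x islimpt UNIV then Limsup (at x) (\<lambda>y. ennreal (dist (f x) (f y) / dist x y)) else 0)"

definition pointwise_Lip_set :: "('a::metric_space \<Rightarrow> 'b::metric_space) \<Rightarrow> 'a set" where
  "pointwise_Lip_set f = {x. Lip f x < \<infinity>}"

text \<open>Nonnegativity follows from the two conditions.\<close>

definition is_seminorm :: "('v::real_vector \<Rightarrow> real) \<Rightarrow> bool" where
  "is_seminorm p \<longleftrightarrow>
     (\<forall>u v. p (u + v) \<le> p u + p v) \<and> (\<forall>a v. p (a *\<^sub>R v) = \<bar>a\<bar> * p v)"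

text \<open>
  If \<open>x\<close> is isolated then \<open>at x\<close> is the trivial filter, along which the upper limit in \<open>ennreal\<close>
  is \<open>0\<close>; the condition on the seminorm is then vacuous.
\<close>

definition metrically_differentiable_at ::
    "'a::metric_space set \<Rightarrow> ('a \<Rightarrow> real ^ 'n) \<Rightarrow> ('a \<Rightarrow> 'b::metric_space) \<Rightarrow> 'a \<Rightarrow> bool" where
  "metrically_differentiable_at U \<phi> f x \<longleftrightarrow>
     x \<in> U \<and>
     (\<exists>md. is_seminorm md \<and>
        Limsup (at x) (\<lambda>y. ennreal (\<bar>dist (f x) (f y) - md (\<phi> x - \<phi> y)\<bar> / dist x y)) = 0)"

end

theory Submission
  imports Defs
begin

text \<open>
The theorem reduces to a statement about Euclidean space. Where \<open>f\<close> has finite pointwise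
Lipschitz constant, it satisfies \<open>dist (f x) (f y) \<le> K * dist x y\<close> for all \<open>y\<close> in a ball
around \<open>x\<close>, with \<open>K\<close> and the radius depending on \<open>x\<close>. Countably many pieces \<open>A\<close> of the chart
domain thus suffice on which \<open>K\<close> and the radius are constant and no two points are as far apart as the radius. On such a
piece \<open>f\<close> is Lipschitz, so \<open>f\<close> read in the chart is a Lipschitz map on \<open>\<phi> ` A\<close>. The distances between its
values extend to a pseudometric \<open>\<rho> \<le> L * dist\<close> on all of Euclidean space
(\<open>lipschitz_map_induces_pseudometric\<close>). The extension makes the sets to which Fubini's theorem
is applied measurable, because \<open>\<rho>\<close> is continuous.

The Euclidean core is the metric form of Rademacher's theorem for such a pseudometric
(\<open>ae_metric_derivative_of_pseudometric\<close>): at almost every \<open>x\<close> there is a seminorm \<open>m\<close> with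
\<open>\<rho> x y = m (y - x) + o (dist x y)\<close>. Its proof has three ingredients.

\<^item> On a line, the quotients \<open>\<rho> t (t + h) / \<bar>h\<bar>\<close> converge at almost every \<open>t\<close>
(\<open>negligible_unequal_derivates\<close>). If they were often below \<open>p\<close> and often above \<open>q > p\<close>, then
an interval that is long for \<open>\<rho>\<close> could not be filled by disjoint intervals that are short for
\<open>\<rho>\<close>, by the triangle inequality; so the density in that interval of the set of such \<open>t\<close> stays away from 1,
and a Vitali covering argument (\<open>negligible_if_sparse_in_small_balls\<close>) makes it null. By Fubini the
directional derivative \<open>m v\<close> exists almost everywhere for countably many, hence for all,
directions \<open>v\<close>.

\<^item> Homogeneity of \<open>m\<close> follows by rescaling \<open>h\<close>, and uniformity in the direction from \<open>\<rho>\<close> being Lipschitz and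
the unit sphere being compact.

\<^item> Subadditivity needs the derivative in direction \<open>v\<close> at \<open>x + h *\<^sub>R u\<close> rather than at \<open>x\<close>. Almost every
\<open>x\<close> is not a porosity point of the sets on which the quotients in direction \<open>v\<close> are uniformly
at most \<open>q\<close> (\<open>negligible_porous_points\<close>), so near \<open>x + h *\<^sub>R u\<close> there is a point of such a set at distance
\<open>o(\<bar>h\<bar>)\<close>.

Returning to the metric space, null sets of Euclidean space have null preimages in the chart domain because the
chart is absolutely continuous. So at almost every \<open>x\<close> in \<open>A\<close> the expansion of \<open>dist (f x) (f a)\<close>
holds for \<open>a\<close> in \<open>A\<close>. A point \<open>y\<close> of the whole space is handled by porosity once more: almost every \<open>x\<close> in \<open>A\<close> is
not a porosity point of \<open>A\<close>, so \<open>y\<close> has a neighbour \<open>a\<close> in \<open>A\<close> at distance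
\<open>o (dist x y)\<close>, and the Lipschitz estimate around \<open>a\<close>, which is valid for all points of the space,
compares \<open>f y\<close> with \<open>f a\<close>.
\<close>

section \<open>A Vitali criterion for null sets and porosity in Euclidean space\<close>

text \<open>
This is Lebesgue's density theorem in the form of a criterion for null sets. The outer measure \<open>m\<close> of a bounded part of \<open>P\<close> is compared with that of an open superset \<open>G\<close> of measure at most \<open>m + e\<close>: disjoint balls in \<open>G\<close>
cover almost all of the set and each contains at most the proportion \<open>c\<close> of it, so \<open>m \<le> c * (m + e)\<close>. The
measurable sets \<open>M\<close> stand in for \<open>P \<inter> cball a r\<close>, since \<open>P\<close> may fail to be measurable.
\<close>

lemma negligible_if_sparse_in_small_balls:
  fixes P :: "'n::euclidean_space set" and c :: real
  assumes c: "0 \<le> c" "c < 1"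
    and sparse: "\<And>x d. x \<in> P \<Longrightarrow> 0 < d \<Longrightarrow>
      \<exists>a r M. 0 < r \<and> r < d \<and> x \<in> cball a r \<and> P \<inter> cball a r \<subseteq> M \<and> M \<in> sets lebesgue \<and>
        emeasure lebesgue M \<le> ennreal c * emeasure lebesgue (cball a r)"
  shows "negligible P"
proof -
  have bdd: "negligible Q" if Q: "Q \<subseteq> P" "bounded Q" for Q
  proof -
    let ?em = "emeasure (lebesgue :: 'n measure)"
    obtain H where H: "H \<in> sets lebesgue" "Q \<subseteq> H"
      and mH: "outer_measure_of lebesgue Q = ?em H"
      using outer_measure_of_attain[of Q lebesgue] by auto
    obtain a0 b0 where Qb: "Q \<subseteq> cbox a0 b0"
      using Q(2) bounded_subset_cbox_symmetric by metis
    have "outer_measure_of lebesgue Q \<le> ?em (cbox a0 b0)"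
      using outer_measure_of_mono[OF Qb, of lebesgue] by simp
    then have Hfin: "?em H < \<infinity>"
      using mH emeasure_compact_finite[OF compact_cbox, of a0 b0]
      by (auto simp: emeasure_completion intro: le_less_trans)
    define m where "m = enn2real (?em H)"
    have m: "?em H = ennreal m" "0 \<le> m"
      using Hfin by (auto simp: m_def)
    \<comment> \<open>One pass of the covering argument improves any bound for the outer measure by \<open>c\<close>.\<close>
    have step: "m \<le> c * (m + e)" if "0 < e" for e :: real
    proof -
      obtain G where G: "open G" "H \<subseteq> G" "?em (G - H) < ennreal e"
        using sets_lebesgue_outer_open[OF H(1) \<open>0 < e\<close>] by metis
      have "?em G = ?em (H \<union> (G - H))" using G(2) by (simp add: Un_absorb1)
      also have "\<dots> \<le> ?em H + ?em (G - H)"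
        using H(1) G(1) by (intro emeasure_subadditive) auto
      also have "\<dots> \<le> ennreal m + ennreal e"
        using G(3) m by (intro add_mono) auto
      finally have emG: "?em G \<le> ennreal (m + e)"
        using m \<open>0 < e\<close> by simp
      define good where "good i M \<longleftrightarrow> Q \<inter> cball (fst i) (snd i) \<subseteq> M \<and> M \<subseteq> cball (fst i) (snd i) \<and>
         M \<in> sets lebesgue \<and> ?em M \<le> ennreal c * ?em (cball (fst i) (snd i))" for i :: "'n \<times> real" and M
      define K where "K = {i. 0 < snd i \<and> cball (fst i) (snd i) \<subseteq> G \<and> (\<exists>M. good i M)}"
      have vit: "\<exists>i. i \<in> K \<and> x \<in> cball (fst i) (snd i) \<and> snd i < d" if x: "x \<in> Q" and "0 < d" for x d
      proof -
        have "x \<in> G" using x H(2) G(2) by auto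
        then obtain d1 where d1: "0 < d1" "cball x d1 \<subseteq> G"
          using G(1) open_contains_cball by blast
        have "x \<in> P" "0 < min d (d1/2)" using x Q \<open>0 < d\<close> d1 by auto
        from sparse[OF this] obtain a r M where M: "0 < r" "r < min d (d1/2)" "x \<in> cball a r"
          "P \<inter> cball a r \<subseteq> M" "M \<in> sets lebesgue" "?em M \<le> ennreal c * ?em (cball a r)"
          by blast
        have "cball a r \<subseteq> cball x d1"
        proof
          fix y assume "y \<in> cball a r"
          then show "y \<in> cball x d1"
            using M(2,3) dist_triangle[of x y a] by (auto simp: dist_commute)
        qed
        with d1 have sub: "cball a r \<subseteq> G" by auto
        have "?em (M \<inter> cball a r) \<le> ?em M"
          using M(5) by (intro emeasure_mono) auto
        then have "good (a, r) (M \<inter> cball a r)"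
          using M Q(1) by (auto simp: good_def)
        then have "(a, r) \<in> K" using M(1) sub by (auto simp: K_def)
        then show ?thesis using M by (intro exI[of _ "(a,r)"]) auto
      qed
      obtain C where C: "countable C" "C \<subseteq> K"
        "pairwise (\<lambda>i j. disjnt (cball (fst i) (snd i)) (cball (fst j) (snd j))) C"
        "negligible (Q - (\<Union>i\<in>C. cball (fst i) (snd i)))"
        by (rule Vitali_covering_theorem_cballs[of K snd Q fst]) (use vit in \<open>auto simp: K_def\<close>)
      have "\<forall>i\<in>C. \<exists>M. good i M" using C(2) by (auto simp: K_def)
      then obtain M where M: "\<And>i. i \<in> C \<Longrightarrow> good i (M i)"
        using bchoice[of C good] by blast
      have disjB: "disjoint_family_on (\<lambda>i. cball (fst i) (snd i)) C"
        using C(3) by (auto simp: disjoint_family_on_def pairwise_def disjnt_def)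
      then have disjM: "disjoint_family_on M C"
        using M unfolding disjoint_family_on_def good_def by blast
      have Mm: "\<And>i. i \<in> C \<Longrightarrow> M i \<in> sets lebesgue" using M by (auto simp: good_def)
      define Z where "Z = Q - (\<Union>i\<in>C. cball (fst i) (snd i))"
      have Z: "Z \<in> null_sets lebesgue"
        using C(4) by (simp add: Z_def negligible_iff_null_sets)
      have UM: "(\<Union>i\<in>C. M i) \<in> sets lebesgue"
        using Mm C(1) by (intro sets.countable_UN') auto
      have "Q \<subseteq> (\<Union>i\<in>C. M i) \<union> Z"
        using M by (fastforce simp: good_def Z_def)
      then have "outer_measure_of lebesgue Q \<le> ?em ((\<Union>i\<in>C. M i) \<union> Z)"
        using outer_measure_of_mono UM Z by (metis outer_measure_of_eq null_setsD2 sets.Un)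
      also have "\<dots> = ?em (\<Union>i\<in>C. M i)"
        using UM Z by (rule emeasure_Un_null_set)
      also have "\<dots> = (\<integral>\<^sup>+i. ?em (M i) \<partial>count_space C)"
        using Mm C(1) disjM by (intro emeasure_UN_countable) auto
      also have "\<dots> \<le> (\<integral>\<^sup>+i. ennreal c * ?em (cball (fst i) (snd i)) \<partial>count_space C)"
        using M by (intro nn_integral_mono) (simp add: good_def del: emeasure_completion)
      also have "\<dots> = ennreal c * (\<integral>\<^sup>+i. ?em (cball (fst i) (snd i)) \<partial>count_space C)"
        by (intro nn_integral_cmult) auto
      also have "(\<integral>\<^sup>+i. ?em (cball (fst i) (snd i)) \<partial>count_space C) = ?em (\<Union>i\<in>C. cball (fst i) (snd i))"
        using C(1) disjB by (intro emeasure_UN_countable[symmetric]) auto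
      also have "ennreal c * \<dots> \<le> ennreal c * ennreal (m + e)"
      proof (rule mult_left_mono)
        have "?em (\<Union>i\<in>C. cball (fst i) (snd i)) \<le> ?em G"
          using C(2) G(1) by (intro emeasure_mono) (auto simp: K_def)
        with emG show "?em (\<Union>i\<in>C. cball (fst i) (snd i)) \<le> ennreal (m + e)" by simp
      qed simp
      finally have "ennreal m \<le> ennreal (c * (m + e))"
        using mH m c \<open>0 < e\<close> by (simp add: ennreal_mult)
      then show ?thesis using c m \<open>0 < e\<close> by simp
    qed
    \<comment> \<open>Any \<open>e\<close> with \<open>c * e < (1 - c) * m\<close> gives a contradiction.\<close>
    have "m = 0"
    proof (rule ccontr)
      assume "m \<noteq> 0"
      with m have "0 < m" by simp
      with c have "0 < (1 - c) * m" by simp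
      from step[OF this] have "m \<le> c * m + c * ((1-c)*m)" by (simp add: algebra_simps)
      also have "c * ((1-c)*m) < 1 * ((1-c)*m)"
        using \<open>0 < (1 - c) * m\<close> c by (intro mult_strict_right_mono) auto
      finally show False by (simp add: algebra_simps)
    qed
    then have "H \<in> null_sets lebesgue" using H m by auto
    then show "negligible Q"
      using H(2) negligible_iff_null_sets negligible_subset by blast
  qed
  have "P = (\<Union>n. P \<inter> ball 0 (real n))"
    by (auto simp: reals_Archimedean2)
  also have "negligible \<dots>"
    by (intro negligible_Union_nat bdd) (auto simp: bounded_Int)
  finally show ?thesis .
qed

text \<open>
The ball of radius \<open>2 * dist x y\<close> around \<open>x\<close> contains the hole around \<open>y\<close>, which takes up the fixed
proportion \<open>(\<eta> / 2) ^ DIM('n)\<close> of its volume.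
\<close>

lemma negligible_uniformly_porous_points:
  fixes E :: "'n::euclidean_space set" and \<eta> :: real
  assumes \<eta>: "0 < \<eta>" "\<eta> \<le> 1"
  shows "negligible {x \<in> E. \<forall>d>0. \<exists>y. 0 < dist x y \<and> dist x y < d \<and> E \<inter> ball y (\<eta> * dist x y) = {}}"
    (is "negligible ?P")
proof (rule negligible_if_sparse_in_small_balls)
  let ?N = "DIM('n)"
  let ?c = "1 - (\<eta> / 2) ^ ?N"
  have "(\<eta> / 2) ^ ?N \<le> 1" "0 < (\<eta> / 2) ^ ?N"
    using \<eta> by (auto intro: power_le_one)
  then show "0 \<le> ?c" "?c < 1" by auto
  fix x and d :: real assume x: "x \<in> ?P" and "0 < d"
  then have "0 < d / 2" by simp
  with x obtain y where y: "0 < dist x y" "dist x y < d / 2" "E \<inter> ball y (\<eta> * dist x y) = {}"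
    by blast
  define t where "t = dist x y"
  let ?B = "cball x (2 * t)" and ?b = "ball y (\<eta> * t)"
  have t: "0 < t" using y t_def by simp
  have sub: "?b \<subseteq> ?B"
  proof
    fix z assume "z \<in> ?b"
    then have "dist y z < \<eta> * t" by simp
    moreover have "\<eta> * t \<le> t" using \<eta> t by simp
    ultimately show "z \<in> ?B" using dist_triangle[of x z y] t_def by auto
  qed
  have "emeasure lebesgue (?B - ?b) = emeasure lebesgue ?B - emeasure lebesgue ?b"
  proof (rule emeasure_Diff)
    show "emeasure lebesgue ?b \<noteq> \<infinity>"
      using t \<eta> by (simp add: emeasure_ball)
  qed (use sub in auto)
  also have "\<dots> = ennreal (unit_ball_vol ?N * (2*t) ^ ?N) - ennreal (unit_ball_vol ?N * (\<eta>*t) ^ ?N)"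
    using t \<eta> by (simp add: emeasure_ball emeasure_cball)
  also have "\<dots> = ennreal (unit_ball_vol ?N * (2*t) ^ ?N - unit_ball_vol ?N * (\<eta>*t) ^ ?N)"
    using t \<eta> by (intro ennreal_minus) auto
  also have "(\<eta>*t) ^ ?N = (\<eta>/2) ^ ?N * (2*t) ^ ?N"
    using power_mult_distrib[of "\<eta>/2" "2*t" ?N] by simp
  also have "unit_ball_vol ?N * (2*t) ^ ?N - unit_ball_vol ?N * ((\<eta>/2) ^ ?N * (2*t) ^ ?N)
      = ?c * (unit_ball_vol ?N * (2*t) ^ ?N)"
    by (simp add: algebra_simps)
  also have "ennreal \<dots> = ennreal ?c * emeasure lebesgue ?B"
    using t \<open>0 \<le> ?c\<close> by (simp add: emeasure_cball ennreal_mult)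
  finally have em: "emeasure lebesgue (?B - ?b) \<le> ennreal ?c * emeasure lebesgue ?B" by simp
  show "\<exists>a r M. 0 < r \<and> r < d \<and> x \<in> cball a r \<and> ?P \<inter> cball a r \<subseteq> M \<and> M \<in> sets lebesgue \<and>
        emeasure lebesgue M \<le> ennreal ?c * emeasure lebesgue (cball a r)"
  proof (intro exI conjI)
    show "?P \<inter> ?B \<subseteq> ?B - ?b" using y(3) t_def by auto
  qed (use y t t_def em in auto)
qed

lemma negligible_porous_points:
  fixes E :: "'n::euclidean_space set"
  shows "negligible {x \<in> E. \<exists>\<eta>>0. \<forall>d>0. \<exists>y. 0 < dist x y \<and> dist x y < d \<and> E \<inter> ball y (\<eta> * dist x y) = {}}"
    (is "negligible ?P")
proof -
  define Q where "Q k = {x \<in> E. \<forall>d>0. \<exists>y. 0 < dist x y \<and> dist x y < d \<and>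
      E \<inter> ball y (1 / real (Suc k) * dist x y) = {}}" for k
  have "?P \<subseteq> (\<Union>k. Q k)"
  proof
    fix x assume "x \<in> ?P"
    then obtain \<eta> where "x \<in> E" "0 < \<eta>"
      and y: "\<And>d. 0 < d \<Longrightarrow> \<exists>y. 0 < dist x y \<and> dist x y < d \<and> E \<inter> ball y (\<eta> * dist x y) = {}"
      by auto
    obtain k where k: "1 / real (Suc k) < \<eta>"
      using \<open>0 < \<eta>\<close> nat_approx_posE by metis
    have "\<exists>y. 0 < dist x y \<and> dist x y < d \<and> E \<inter> ball y (1 / real (Suc k) * dist x y) = {}"
      if d: "0 < d" for d
    proof -
      obtain y where y: "0 < dist x y" "dist x y < d" "E \<inter> ball y (\<eta> * dist x y) = {}"
        using y[OF d] by blast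
      have "ball y (1 / real (Suc k) * dist x y) \<subseteq> ball y (\<eta> * dist x y)"
        using k by (intro subset_ball mult_right_mono) auto
      then show ?thesis using y by blast
    qed
    with \<open>x \<in> E\<close> show "x \<in> (\<Union>k. Q k)" by (auto simp: Q_def)
  qed
  moreover have "negligible (\<Union>k. Q k)"
    unfolding Q_def by (intro negligible_Union_nat negligible_uniformly_porous_points) auto
  ultimately show ?thesis using negligible_subset by blast
qed

section \<open>Lipschitz pseudometrics on a line\<close>

locale lipschitz_pseudometric =
  fixes \<rho> :: "'v::metric_space \<Rightarrow> 'v \<Rightarrow> real" and L :: real
  assumes L_nonneg: "0 \<le> L"
    and sym: "\<rho> x y = \<rho> y x"
    and triangle: "\<rho> x z \<le> \<rho> x y + \<rho> y z"
    and nonneg: "0 \<le> \<rho> x y"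
    and le_dist: "\<rho> x y \<le> L * dist x y"

context lipschitz_pseudometric
begin

lemma self_eq_0: "\<rho> x x = 0"
  using nonneg[of x x] le_dist[of x x] by simp

lemma diff_le: "\<bar>\<rho> x y - \<rho> x' y'\<bar> \<le> L * dist x x' + L * dist y y'"
proof -
  have "\<rho> x y \<le> \<rho> x x' + (\<rho> x' y' + \<rho> y' y)" "\<rho> x' y' \<le> \<rho> x' x + (\<rho> x y + \<rho> y y')"
    using triangle[of x y x'] triangle[of x' y y'] triangle[of x' y' x] triangle[of x y' y] by auto
  then show ?thesis
    using le_dist[of x x'] le_dist[of y y'] sym[of x x'] sym[of y y'] by auto
qed

end

text \<open>
The triangle inequality along a chain: each interval of the family contributes at most \<open>p\<close> times
its length, and the gaps contribute at most \<open>L\<close> times theirs.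
\<close>

lemma distance_le_by_disjoint_short_intervals:
  fixes \<rho> :: "real \<Rightarrow> real \<Rightarrow> real" and l u :: "'i \<Rightarrow> real"
  assumes "lipschitz_pseudometric \<rho> L"
    and "finite C" "s \<le> t"
    and "\<And>i. i \<in> C \<Longrightarrow> l i \<le> u i \<and> s \<le> l i \<and> u i \<le> t \<and> \<rho> (l i) (u i) \<le> p * (u i - l i)"
    and "pairwise (\<lambda>i j. disjnt {l i..u i} {l j..u j}) C"
  shows "\<rho> s t \<le> L * (t - s) - (L - p) * (\<Sum>i\<in>C. u i - l i)"
  using assms(2-)
proof (induction C arbitrary: s t rule: finite_psubset_induct)
  case (psubset C)
  interpret lipschitz_pseudometric \<rho> L by fact
  show ?case
  proof (cases "C = {}")
    case True
    with psubset.prems le_dist[of s t] show ?thesis by (simp add: dist_real_def)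
  next
    case False
    then obtain k where k: "k \<in> C" by auto
    \<comment> \<open>The other intervals lie to the left or to the right of a chosen one, which splits the chain in two.\<close>
    define A where "A = {i \<in> C. u i < l k}"
    define B where "B = {i \<in> C. u k < l i}"
    have split: "C = insert k (A \<union> B)"
    proof -
      have "u i < l k \<or> u k < l i" if "i \<in> C" "i \<noteq> k" for i
      proof -
        have "disjnt {l i..u i} {l k..u k}" using psubset.prems(3) that k by (auto simp: pairwise_def)
        then have "max (l i) (l k) \<notin> {l i..u i} \<inter> {l k..u k}" by (auto simp: disjnt_def)
        with psubset.prems(2)[OF that(1)] psubset.prems(2)[OF k] show ?thesis by auto
      qed
      then show ?thesis using k by (auto simp: A_def B_def)
    qed
    have ni: "k \<notin> A" "k \<notin> B" "A \<inter> B = {}"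
      using psubset.prems(2)[OF k] psubset.prems(2) by (fastforce simp: A_def B_def)+
    have "A \<subset> C" "B \<subset> C" using ni k by (auto simp: A_def B_def)
    have pA: "pairwise (\<lambda>i j. disjnt {l i..u i} {l j..u j}) A"
     and pB: "pairwise (\<lambda>i j. disjnt {l i..u i} {l j..u j}) B"
      using psubset.prems(3) \<open>A \<subset> C\<close> \<open>B \<subset> C\<close> by (auto intro: pairwise_subset)
    have 1: "\<rho> s (l k) \<le> L * (l k - s) - (L - p) * (\<Sum>i\<in>A. u i - l i)"
      using psubset.prems(2)[OF k] psubset.prems(2)
      by (intro psubset.IH \<open>A \<subset> C\<close> pA) (force simp: A_def)+
    have 2: "\<rho> (u k) t \<le> L * (t - u k) - (L - p) * (\<Sum>i\<in>B. u i - l i)"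
      using psubset.prems(2)[OF k] psubset.prems(2)
      by (intro psubset.IH \<open>B \<subset> C\<close> pB) (force simp: B_def)+
    have sum: "(\<Sum>i\<in>C. u i - l i) = (u k - l k) + ((\<Sum>i\<in>A. u i - l i) + (\<Sum>i\<in>B. u i - l i))"
      using psubset.hyps ni \<open>A \<subset> C\<close> \<open>B \<subset> C\<close> unfolding split
      by (subst sum.insert) (auto simp: sum.union_disjoint finite_subset)
    have "\<rho> s t \<le> \<rho> s (l k) + (\<rho> (l k) (u k) + \<rho> (u k) t)"
      using triangle[of s t "l k"] triangle[of "l k" t "u k"] by simp
    then show ?thesis
      unfolding sum using 1 2 psubset.prems(2)[OF k] by (simp add: algebra_simps)
  qed
qed

text \<open>
Near such a \<open>t\<close> there are arbitrarily small intervals that are long for \<open>\<rho>\<close>, by the factor \<open>q\<close>. Inside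
one of them the set is covered, in the sense of Vitali, by intervals that are short, by the factor
\<open>p\<close>; disjoint short intervals cover at most the proportion \<open>(L - q) / (L - p)\<close> of the long one, and
hence so does the set.
\<close>

lemma negligible_unequal_derivates:
  fixes \<rho> :: "real \<Rightarrow> real \<Rightarrow> real"
  assumes "lipschitz_pseudometric \<rho> L" and "p < q"
  shows "negligible {t. (\<forall>d>0. \<exists>h. h \<noteq> 0 \<and> \<bar>h\<bar> < d \<and> \<rho> t (t + h) < p * \<bar>h\<bar>) \<and>
                        (\<forall>d>0. \<exists>h. h \<noteq> 0 \<and> \<bar>h\<bar> < d \<and> q * \<bar>h\<bar> < \<rho> t (t + h))}"
    (is "negligible ?P")
proof (cases "q < L")
  case False
  interpret lipschitz_pseudometric \<rho> L by fact
  have "\<rho> t (t + h) \<le> q * \<bar>h\<bar>" for t h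
  proof -
    have "\<rho> t (t + h) \<le> L * \<bar>h\<bar>" using le_dist[of t "t + h"] by (simp add: dist_real_def)
    also have "\<dots> \<le> q * \<bar>h\<bar>" using False by (intro mult_right_mono) auto
    finally show ?thesis .
  qed
  then have "?P = {}" by (fastforce simp: not_less[symmetric] intro: zero_less_one)
  then show ?thesis by (simp only: negligible_empty)
next
  case True
  interpret lipschitz_pseudometric \<rho> L by fact
  \<comment> \<open>The interval between \<open>t\<close> and \<open>t + h\<close>, for either sign of \<open>h\<close>, as a ball around its midpoint.\<close>
  have centred: "\<rho> (t + h/2 - \<bar>h\<bar>/2) (t + h/2 + \<bar>h\<bar>/2) = \<rho> t (t + h)" for t h
  proof (cases "0 \<le> h")
    case True
    then have "t + h/2 - \<bar>h\<bar>/2 = t" "t + h/2 + \<bar>h\<bar>/2 = t + h" by auto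
    then show ?thesis by (simp only:)
  next
    case False
    then have "t + h/2 - \<bar>h\<bar>/2 = t + h" "t + h/2 + \<bar>h\<bar>/2 = t" by auto
    then show ?thesis by (simp only: sym)
  qed
  let ?c = "(L - q) / (L - p)"
  have c: "0 \<le> ?c" "?c < 1" using True \<open>p < q\<close> by auto
  show ?thesis
  proof (rule negligible_if_sparse_in_small_balls[OF c])
    fix t d :: real assume t: "t \<in> ?P" and "0 < d"
    then obtain h where h: "h \<noteq> 0" "\<bar>h\<bar> < d" "q * \<bar>h\<bar> < \<rho> t (t + h)" by blast
    define a r where "a = t + h / 2" and "r = \<bar>h\<bar> / 2"
    have r: "0 < r" "r < d" "t \<in> cball a r" using h by (auto simp: a_def r_def dist_real_def)
    \<comment> \<open>The ball \<open>cball a r\<close> is one long interval; the short ones inside it cannot fill it.\<close>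
    have long: "q * (2 * r) < \<rho> (a - r) (a + r)"
      using h centred by (simp add: a_def r_def)
    define K where "K = {i. 0 < snd i \<and> a - r < fst i - snd i \<and> fst i + snd i < a + r \<and>
      \<rho> (fst i - snd i) (fst i + snd i) \<le> p * (2 * snd i)}"
    have vit: "\<exists>i. i \<in> K \<and> x \<in> cball (fst i) (snd i) \<and> snd i < e"
      if x: "x \<in> ?P \<inter> ball a r" and "0 < e" for x e
    proof -
      have "0 < min e (r - dist a x)" using x \<open>0 < e\<close> by auto
      with x obtain k where k: "k \<noteq> 0" "\<bar>k\<bar> < min e (r - dist a x)" "\<rho> x (x + k) < p * \<bar>k\<bar>"
        by blast
      then have "(x + k / 2, \<bar>k\<bar> / 2) \<in> K"
        using centred[of x k] by (auto simp: K_def dist_real_def abs_if split: if_splits)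
      moreover have "x \<in> cball (x + k / 2) (\<bar>k\<bar> / 2)" by (auto simp: dist_real_def)
      ultimately show ?thesis using k by (intro exI[of _ "(x + k / 2, \<bar>k\<bar> / 2)"]) auto
    qed
    obtain C where C: "countable C" "C \<subseteq> K"
      "pairwise (\<lambda>i j. disjnt (cball (fst i) (snd i)) (cball (fst j) (snd j))) C"
      "negligible (?P \<inter> ball a r - (\<Union>i\<in>C. cball (fst i) (snd i)))"
      by (rule Vitali_covering_theorem_cballs[of K snd "?P \<inter> ball a r" fst])
         (use vit in \<open>auto simp: K_def\<close>)
    let ?W = "\<Union>i\<in>C. cball (fst i) (snd i)"
    \<comment> \<open>Short intervals of total length \<open>l\<close> give \<open>\<rho> \<le> p * l + L * (2 * r - l)\<close>, which exceeds \<open>q * (2 * r)\<close> only if \<open>l\<close> is at most \<open>?c * (2 * r)\<close>.\<close>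
    have bound: "measure lebesgue (\<Union>i\<in>F. cball (fst i) (snd i)) \<le> ?c * (2 * r)"
      if F: "F \<subseteq> C" "finite F" for F
    proof -
      have "\<rho> (a - r) (a + r) \<le> L * ((a + r) - (a - r)) -
          (L - p) * (\<Sum>i\<in>F. (fst i + snd i) - (fst i - snd i))"
      proof (rule distance_le_by_disjoint_short_intervals[OF assms(1) F(2)])
        show "pairwise (\<lambda>i j. disjnt {fst i - snd i..fst i + snd i} {fst j - snd j..fst j + snd j}) F"
          using pairwise_subset[OF C(3) F(1)] by (simp add: cball_eq_atLeastAtMost)
      qed (use F C(2) r in \<open>auto simp: K_def\<close>)
      with long have "(L - p) * (\<Sum>i\<in>F. 2 * snd i) \<le> (L - q) * (2 * r)"
        by (simp add: algebra_simps)
      then have le: "(\<Sum>i\<in>F. 2 * snd i) \<le> ?c * (2 * r)"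
        using True \<open>p < q\<close> by (simp add: field_simps)
      have "measure lebesgue (\<Union>i\<in>F. cball (fst i) (snd i))
          \<le> (\<Sum>i\<in>F. measure lebesgue (cball (fst i) (snd i)))"
        by (intro measure_UNION_le F) auto
      also have "\<dots> = (\<Sum>i\<in>F. 2 * snd i)"
        using F C(2) by (intro sum.cong) (auto simp: K_def cball_eq_atLeastAtMost)
      finally show ?thesis using le by simp
    qed
    have W: "?W \<in> lmeasurable" "measure lebesgue ?W \<le> ?c * (2 * r)"
      using fmeasurable_UN_bound[OF C(1) _ bound] measure_UN_bound[OF C(1) _ bound] by auto
    define Z where "Z = (?P \<inter> ball a r - ?W) \<union> {a - r, a + r}"
    have Z: "Z \<in> null_sets lebesgue"
      using C(4) unfolding Z_def negligible_iff_null_sets[symmetric] by (auto intro: negligible_Un)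
    have "emeasure lebesgue (?W \<union> Z) = emeasure lebesgue ?W"
      using Z W by (intro emeasure_Un_null_set) auto
    also have "\<dots> = ennreal (measure lebesgue ?W)"
      using W(1) by (rule emeasure_eq_measure2)
    also have "\<dots> \<le> ennreal (?c * (2 * r))"
      using W(2) by (rule ennreal_leI)
    also have "\<dots> = ennreal ?c * emeasure lebesgue (cball a r)"
      using c r by (subst ennreal_mult) (auto simp: cball_eq_atLeastAtMost)
    finally have em: "emeasure lebesgue (?W \<union> Z) \<le> ennreal ?c * emeasure lebesgue (cball a r)" .
    have sub: "?P \<inter> cball a r \<subseteq> ?W \<union> Z"
    proof
      fix x assume "x \<in> ?P \<inter> cball a r"
      then have "x \<in> ?P" "x \<in> ball a r \<or> x = a - r \<or> x = a + r" by (auto simp: dist_real_def)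
      then show "x \<in> ?W \<union> Z" unfolding Z_def by blast
    qed
    show "\<exists>a r M. 0 < r \<and> r < d \<and> t \<in> cball a r \<and> ?P \<inter> cball a r \<subseteq> M \<and> M \<in> sets lebesgue \<and>
        emeasure lebesgue M \<le> ennreal ?c * emeasure lebesgue (cball a r)"
    proof (intro exI conjI)
      show "?W \<union> Z \<in> sets lebesgue" using W(1) Z by auto
    qed (fact r sub em)+
  qed
qed

section \<open>Directional derivatives of a Lipschitz pseudometric\<close>

lemma null_set_if_null_on_parallel_lines:
  fixes N :: "'v::euclidean_space set" and v :: 'v
  assumes N: "N \<in> sets borel"
    and null: "\<And>x. negligible {t::real. x + t *\<^sub>R v \<in> N}"
  shows "negligible N"
proof -
  have meas: "(\<lambda>(x, t). indicator N (x + t *\<^sub>R v) * indicator {0..1::real} t :: ennreal)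
      \<in> borel_measurable (lborel \<Otimes>\<^sub>M lborel)"
  proof -
    have "(\<lambda>z::'v \<times> real. fst z + snd z *\<^sub>R v) \<in> borel_measurable (lborel \<Otimes>\<^sub>M lborel)"
      by measurable
    then show ?thesis using N by (simp add: split_beta')
  qed
  \<comment> \<open>Averaging over the translates of \<open>N\<close> by \<open>t *\<^sub>R v\<close> with \<open>t\<close> in the unit interval, which all have the same measure.\<close>
  have "emeasure lborel N = (\<integral>\<^sup>+t. emeasure lborel N * indicator {0..1::real} t \<partial>lborel)"
    by (subst nn_integral_cmult_indicator) auto
  also have "\<dots> = (\<integral>\<^sup>+t. (\<integral>\<^sup>+x. indicator N (x + t *\<^sub>R v) * indicator {0..1::real} t \<partial>lborel) \<partial>lborel)"
  proof (intro nn_integral_cong)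
    fix t :: real
    have "emeasure lborel N = (\<integral>\<^sup>+x. indicator N x \<partial>lborel)"
      using N by simp
    also have "\<dots> = (\<integral>\<^sup>+x. indicator N x \<partial>(distr lborel borel ((+) (t *\<^sub>R v))))"
      by (simp add: lborel_distr_plus)
    also have "\<dots> = (\<integral>\<^sup>+x. indicator N (x + t *\<^sub>R v) \<partial>lborel)"
      using N by (subst nn_integral_distr) (auto simp: add.commute)
    finally show "emeasure lborel N * indicator {0..1} t
        = (\<integral>\<^sup>+x. indicator N (x + t *\<^sub>R v) * indicator {0..1} t \<partial>lborel)"
      by (auto simp: indicator_def)
  qed
  also have "\<dots> = (\<integral>\<^sup>+x. (\<integral>\<^sup>+t. indicator N (x + t *\<^sub>R v) * indicator {0..1::real} t \<partial>lborel) \<partial>lborel)"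
    using lborel_pair.Fubini'[OF meas] by simp
  also have "\<dots> = (\<integral>\<^sup>+(x::'v). 0 \<partial>lborel)"
  proof (intro nn_integral_cong)
    fix x :: 'v
    let ?T = "{t::real. x + t *\<^sub>R v \<in> N}"
    have "?T = (\<lambda>t. x + t *\<^sub>R v) -` N \<inter> space borel" by auto
    also have "\<dots> \<in> sets borel"
      using N by (intro measurable_sets[of _ borel borel]) auto
    finally have "?T \<in> sets borel" .
    then have "?T \<in> null_sets lborel"
      using null[of x] by (simp add: negligible_iff_null_sets null_sets_completion_iff)
    then have "AE t in lborel. t \<notin> ?T" by (rule AE_not_in)
    then have "(\<integral>\<^sup>+t. indicator N (x + t *\<^sub>R v) * indicator {0..1::real} t \<partial>lborel)
        = (\<integral>\<^sup>+(t::real). 0 \<partial>lborel)"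
      by (intro nn_integral_cong_AE) (auto elim!: eventually_mono simp: indicator_def)
    then show "(\<integral>\<^sup>+t. indicator N (x + t *\<^sub>R v) * indicator {0..1::real} t \<partial>lborel) = 0" by simp
  qed
  finally have "N \<in> null_sets lborel" using N by auto
  then show ?thesis by (simp add: negligible_iff_null_sets null_sets_completionI)
qed
text \<open>
Convergence in the form needed below: excluding oscillation between each pair \<open>p < q\<close> is a
condition that survives small perturbations of \<open>f\<close>, so it passes from a dense set of directions to all of them.
\<close>

lemma convergent_if_no_oscillation:
  fixes f :: "'i \<Rightarrow> real"
  assumes "F \<noteq> bot"
    and bounds: "\<And>h. 0 \<le> f h" "\<And>h. f h \<le> B"
    and no_osc: "\<And>p q. p < q \<Longrightarrow> (\<forall>\<^sub>F h in F. p \<le> f h) \<or> (\<forall>\<^sub>F h in F. f h \<le> q)"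
  shows "\<exists>m. (f \<longlongrightarrow> m) F"
proof -
  define S where "S = {p. \<forall>\<^sub>F h in F. p \<le> f h}"
  have "p \<le> B" if "p \<in> S" for p
  proof -
    have "\<forall>\<^sub>F h in F. p \<le> f h" using that by (simp add: S_def)
    then obtain h where "p \<le> f h" using \<open>F \<noteq> bot\<close> eventually_happens by blast
    then show ?thesis using bounds(2)[of h] by simp
  qed
  then have bdd: "bdd_above S" by (rule bdd_aboveI)
  have "0 \<in> S" using bounds by (simp add: S_def)
  have "(f \<longlongrightarrow> Sup S) F"
  proof (rule order_tendstoI)
    fix a assume "a < Sup S"
    then obtain p where "p \<in> S" "a < p" using less_cSupE \<open>0 \<in> S\<close> by blast
    then show "\<forall>\<^sub>F h in F. a < f h" by (auto simp: S_def elim: eventually_mono)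
  next
    fix a assume a: "Sup S < a"
    define p q where "p = (2 * Sup S + a) / 3" and "q = (Sup S + 2 * a) / 3"
    have pq: "Sup S < p" "p < q" "q < a" using a by (auto simp: p_def q_def)
    then have "p \<notin> S" using cSup_upper[OF _ bdd, of p] by auto
    then have "\<forall>\<^sub>F h in F. f h \<le> q" using no_osc[OF \<open>p < q\<close>] by (auto simp: S_def)
    then show "\<forall>\<^sub>F h in F. f h < a" using pq(3) by (auto elim: eventually_mono)
  qed
  then show ?thesis ..
qed

lemma negligible_unequal_directional_derivates:
  fixes \<rho> :: "'v::euclidean_space \<Rightarrow> 'v \<Rightarrow> real"
  assumes "lipschitz_pseudometric \<rho> L" and "p < q"
  shows "negligible {x. \<not> (\<forall>\<^sub>F h in at 0. p \<le> \<rho> x (x + h *\<^sub>R v) / \<bar>h\<bar>) \<and>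
                        \<not> (\<forall>\<^sub>F h in at 0. \<rho> x (x + h *\<^sub>R v) / \<bar>h\<bar> \<le> q)}"
    (is "negligible ?N")
proof (rule null_set_if_null_on_parallel_lines[where v = v])
  interpret lipschitz_pseudometric \<rho> L by fact
  have "h \<noteq> 0 \<Longrightarrow> p \<le> y / \<bar>h\<bar> \<longleftrightarrow> \<not> y < p * \<bar>h\<bar>"
       "h \<noteq> 0 \<Longrightarrow> y / \<bar>h\<bar> \<le> q \<longleftrightarrow> \<not> q * \<bar>h\<bar> < y" for y h :: real
    by (auto simp: field_simps)
  note quot = this
  have lower: "(\<forall>\<^sub>F h in at 0. p \<le> \<rho> x (x + h *\<^sub>R v) / \<bar>h\<bar>) \<longleftrightarrow>
      (\<exists>d>0. \<forall>h. h \<noteq> 0 \<and> \<bar>h\<bar> < d \<longrightarrow> \<not> \<rho> x (x + h *\<^sub>R v) < p * \<bar>h\<bar>)" for x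
    unfolding eventually_at by (simp add: quot)
  have upper: "(\<forall>\<^sub>F h in at 0. \<rho> x (x + h *\<^sub>R v) / \<bar>h\<bar> \<le> q) \<longleftrightarrow>
      (\<exists>d>0. \<forall>h. h \<noteq> 0 \<and> \<bar>h\<bar> < d \<longrightarrow> \<not> q * \<bar>h\<bar> < \<rho> x (x + h *\<^sub>R v))" for x
    unfolding eventually_at by (simp add: quot)
  have N: "?N = {x. (\<forall>d>0. \<exists>h. h \<noteq> 0 \<and> \<bar>h\<bar> < d \<and> \<rho> x (x + h *\<^sub>R v) < p * \<bar>h\<bar>) \<and>
                    (\<forall>d>0. \<exists>h. h \<noteq> 0 \<and> \<bar>h\<bar> < d \<and> q * \<bar>h\<bar> < \<rho> x (x + h *\<^sub>R v))}"
    unfolding lower upper by blast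
  have cont: "continuous_on UNIV (\<lambda>x. \<rho> x (x + h *\<^sub>R v))" for h
  proof (rule lipschitz_on_continuous_on[of "2 * L"], rule lipschitz_onI)
    fix x y :: 'v
    show "dist (\<rho> x (x + h *\<^sub>R v)) (\<rho> y (y + h *\<^sub>R v)) \<le> 2 * L * dist x y"
      using diff_le[of x "x + h *\<^sub>R v" y "y + h *\<^sub>R v"] by (simp add: dist_real_def)
  qed (use L_nonneg in simp)
  \<comment> \<open>Continuity of \<open>\<rho>\<close> makes both halves of the oscillation set countable intersections of open sets.\<close>
  define G1 where "G1 d = (\<Union>h\<in>{h. h \<noteq> 0 \<and> \<bar>h\<bar> < d}. {x. \<rho> x (x + h *\<^sub>R v) < p * \<bar>h\<bar>})" for d :: real
  define G2 where "G2 d = (\<Union>h\<in>{h. h \<noteq> 0 \<and> \<bar>h\<bar> < d}. {x. q * \<bar>h\<bar> < \<rho> x (x + h *\<^sub>R v)})" for d :: real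
  have opn: "open (G1 d)" "open (G2 d)" for d
    unfolding G1_def G2_def by (intro open_UN ballI open_Collect_less cont continuous_on_const)+
  have "?N = (\<Inter>k. G1 (1 / real (Suc k)) \<inter> G2 (1 / real (Suc k)))"
  proof (intro set_eqI iffI)
    fix x assume "x \<in> ?N"
    then show "x \<in> (\<Inter>k. G1 (1 / real (Suc k)) \<inter> G2 (1 / real (Suc k)))"
      unfolding N by (simp add: G1_def G2_def)
  next
    fix x assume x: "x \<in> (\<Inter>k. G1 (1 / real (Suc k)) \<inter> G2 (1 / real (Suc k)))"
    have "x \<in> G1 d \<and> x \<in> G2 d" if d: "0 < d" for d
    proof -
      obtain k where k: "1 / real (Suc k) < d" using d nat_approx_posE by metis
      have "x \<in> G1 (1 / real (Suc k))" "x \<in> G2 (1 / real (Suc k))" using x by auto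
      with k show ?thesis unfolding G1_def G2_def by fastforce
    qed
    then show "x \<in> ?N" unfolding N G1_def G2_def by blast
  qed
  also have "\<dots> \<in> sets borel" using opn by (intro sets.countable_INT'') auto
  finally show "?N \<in> sets borel" .
  fix x :: 'v
  have "lipschitz_pseudometric (\<lambda>s t. \<rho> (x + s *\<^sub>R v) (x + t *\<^sub>R v)) (L * norm v)"
  proof
    fix s t u :: real
    show "\<rho> (x + s *\<^sub>R v) (x + t *\<^sub>R v) \<le> L * norm v * dist s t"
      using le_dist[of "x + s *\<^sub>R v" "x + t *\<^sub>R v"]
      by (simp add: dist_norm scaleR_diff_left[symmetric] algebra_simps del: scaleR_diff_left)
  qed (use sym triangle nonneg L_nonneg in auto)
  from negligible_unequal_derivates[OF this \<open>p < q\<close>]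
  show "negligible {t. x + t *\<^sub>R v \<in> ?N}"
    unfolding N by (simp add: scaleR_add_left add.assoc)
qed

lemma ae_directional_derivatives:
  fixes \<rho> :: "'v::euclidean_space \<Rightarrow> 'v \<Rightarrow> real"
  assumes "lipschitz_pseudometric \<rho> L"
  obtains N where "negligible N"
    "\<And>x. x \<notin> N \<Longrightarrow> \<exists>m. \<forall>v. ((\<lambda>h. \<rho> x (x + h *\<^sub>R v) / \<bar>h\<bar>) \<longlongrightarrow> m v) (at 0)"
proof -
  interpret lipschitz_pseudometric \<rho> L by fact
  obtain D :: "'v set" where D: "countable D" "\<And>X. open X \<Longrightarrow> X \<noteq> {} \<Longrightarrow> \<exists>d\<in>D. d \<in> X"
    using countable_dense_exists by metis
  define \<phi> where "\<phi> x v h = \<rho> x (x + h *\<^sub>R v) / \<bar>h\<bar>" for x v h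
  define N where "N v p q = {x. \<not> (\<forall>\<^sub>F h in at 0. p \<le> \<phi> x v h) \<and> \<not> (\<forall>\<^sub>F h in at 0. \<phi> x v h \<le> q)}" for v and p q :: real
  define I :: "('v \<times> real \<times> real) set" where "I = {(v, p, q). v \<in> D \<and> p \<in> \<rat> \<and> q \<in> \<rat> \<and> p < q}"
  have "I \<subseteq> D \<times> \<rat> \<times> \<rat>" by (auto simp: I_def)
  then have "countable I"
    using D(1) countable_rat by (meson countable_SIGMA countable_subset)
  show thesis
  proof
    show "negligible (\<Union>(v, p, q)\<in>I. N v p q)"
      using \<open>countable I\<close> negligible_unequal_directional_derivates[OF assms]
      by (intro negligible_countable_Union) (auto simp: I_def N_def \<phi>_def)
    fix x assume x: "x \<notin> (\<Union>(v, p, q)\<in>I. N v p q)"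
    have lip: "\<bar>\<phi> x v h - \<phi> x w h\<bar> \<le> L * dist v w" for v w h
    proof (cases "h = 0")
      case False
      have "\<bar>\<rho> x (x + h *\<^sub>R v) - \<rho> x (x + h *\<^sub>R w)\<bar> \<le> L * dist v w * \<bar>h\<bar>"
        using diff_le[of x "x + h *\<^sub>R v" x "x + h *\<^sub>R w"]
        by (simp add: dist_norm scaleR_diff_right[symmetric] algebra_simps del: scaleR_diff_right)
      with False show ?thesis
        by (simp add: \<phi>_def diff_divide_distrib[symmetric] abs_divide field_simps)
    qed (use L_nonneg in \<open>simp add: \<phi>_def\<close>)
    have "\<exists>m. (\<phi> x v \<longlongrightarrow> m) (at 0)" for v
    proof (rule convergent_if_no_oscillation)
      show "0 \<le> \<phi> x v h" for h using nonneg by (simp add: \<phi>_def)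
      show "\<phi> x v h \<le> L * norm v" for h
        using lip[of v h 0] nonneg[of x "x + h *\<^sub>R v"] by (simp add: \<phi>_def self_eq_0)
      fix p q :: real assume "p < q"
      \<comment> \<open>Moving \<open>v\<close> to a dense direction costs less than \<open>e\<close>, so rational bounds are taken that far inside \<open>p\<close> and \<open>q\<close>.\<close>
      define e where "e = (q - p) / 4"
      have e: "0 < e" using \<open>p < q\<close> by (simp add: e_def)
      obtain p' where p': "p' \<in> \<rat>" "p + e < p'" "p' < p + 2 * e"
        using Rats_dense_in_real[of "p + e" "p + 2 * e"] e by auto
      obtain q' where q': "q' \<in> \<rat>" "q - 2 * e < q'" "q' < q - e"
        using Rats_dense_in_real[of "q - 2 * e" "q - e"] e by auto
      have "p' < q'" using p' q' by (simp add: e_def field_simps)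
      obtain w where w: "w \<in> D" "w \<in> ball v (e / (L + 1))"
        using D(2)[of "ball v (e / (L + 1))"] e L_nonneg by (force simp: not_le)
      have "L * dist v w \<le> (L + 1) * dist v w" by (simp add: algebra_simps)
      also have "\<dots> < e" using w L_nonneg by (simp add: field_simps)
      finally have close: "\<bar>\<phi> x v h - \<phi> x w h\<bar> < e" for h using lip[of v h w] by simp
      have "(w, p', q') \<in> I" using w p' q' \<open>p' < q'\<close> by (simp add: I_def)
      with x have "x \<notin> N w p' q'" by auto
      then consider "\<forall>\<^sub>F h in at 0. p' \<le> \<phi> x w h" | "\<forall>\<^sub>F h in at 0. \<phi> x w h \<le> q'"
        by (auto simp: N_def)
      then show "(\<forall>\<^sub>F h in at 0. p \<le> \<phi> x v h) \<or> (\<forall>\<^sub>F h in at 0. \<phi> x v h \<le> q)"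
      proof cases
        case 1
        then have "\<forall>\<^sub>F h in at 0. p \<le> \<phi> x v h"
        proof (rule eventually_mono)
          fix h assume "p' \<le> \<phi> x w h" then show "p \<le> \<phi> x v h" using close[of h] p' by linarith
        qed
        then show ?thesis ..
      next
        case 2
        then have "\<forall>\<^sub>F h in at 0. \<phi> x v h \<le> q"
        proof (rule eventually_mono)
          fix h assume "\<phi> x w h \<le> q'" then show "\<phi> x v h \<le> q" using close[of h] q' by linarith
        qed
        then show ?thesis ..
      qed
    qed simp
    then have "\<forall>v. \<exists>m. (\<phi> x v \<longlongrightarrow> m) (at 0)" ..
    from choice[OF this] show "\<exists>m. \<forall>v. ((\<lambda>h. \<rho> x (x + h *\<^sub>R v) / \<bar>h\<bar>) \<longlongrightarrow> m v) (at 0)"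
      unfolding \<phi>_def .
  qed
qed

section \<open>The metric derivative is a seminorm almost everywhere\<close>

context
  fixes \<rho> :: "'v::euclidean_space \<Rightarrow> 'v \<Rightarrow> real" and L :: real and x :: 'v and m :: "'v \<Rightarrow> real"
  assumes pseudometric: "lipschitz_pseudometric \<rho> L"
    and derivative: "\<And>v. ((\<lambda>h. \<rho> x (x + h *\<^sub>R v) / \<bar>h\<bar>) \<longlongrightarrow> m v) (at 0)"
begin

interpretation lipschitz_pseudometric \<rho> L by (rule pseudometric)

lemma quotient_lipschitz:
  "\<bar>\<rho> x (x + h *\<^sub>R v) - \<rho> x (x + h *\<^sub>R w)\<bar> \<le> L * norm (v - w) * \<bar>h\<bar>"
  using diff_le[of x "x + h *\<^sub>R v" x "x + h *\<^sub>R w"]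
  by (simp add: dist_norm scaleR_diff_right[symmetric] algebra_simps del: scaleR_diff_right)

lemma derivative_lipschitz: "\<bar>m v - m w\<bar> \<le> L * norm (v - w)"
proof (rule tendsto_upperbound)
  show "((\<lambda>h. \<bar>\<rho> x (x + h *\<^sub>R v) / \<bar>h\<bar> - \<rho> x (x + h *\<^sub>R w) / \<bar>h\<bar>\<bar>) \<longlongrightarrow> \<bar>m v - m w\<bar>) (at 0)"
    by (intro tendsto_intros derivative)
  show "\<forall>\<^sub>F h in at 0. \<bar>\<rho> x (x + h *\<^sub>R v) / \<bar>h\<bar> - \<rho> x (x + h *\<^sub>R w) / \<bar>h\<bar>\<bar> \<le> L * norm (v - w)"
  proof -
    have "\<bar>\<rho> x (x + h *\<^sub>R v) / \<bar>h\<bar> - \<rho> x (x + h *\<^sub>R w) / \<bar>h\<bar>\<bar> \<le> L * norm (v - w)" if "h \<noteq> 0" for h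
      using quotient_lipschitz[of h v w] that
      by (simp add: diff_divide_distrib[symmetric] abs_divide field_simps)
    then show ?thesis by (auto simp: eventually_at intro: exI[of _ 1])
  qed
qed simp

lemma derivative_zero: "m 0 = 0"
proof -
  have "((\<lambda>h::real. 0) \<longlongrightarrow> m 0) (at 0)" using derivative[of 0] by (simp add: self_eq_0)
  then show ?thesis by (simp add: tendsto_const_iff)
qed

lemma derivative_homogeneous: "m (a *\<^sub>R v) = \<bar>a\<bar> * m v"
proof (cases "a = 0")
  case True
  then show ?thesis by (simp add: derivative_zero)
next
  case False
  have "filterlim (\<lambda>h. h * a) (at 0) (at (0::real))"
    using False by (auto simp: filterlim_at eventually_at intro!: tendsto_eq_intros exI[of _ 1])
  from tendsto_mult[OF tendsto_const[of "\<bar>a\<bar>"] filterlim_compose[OF derivative[of v] this]]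
  have "((\<lambda>h. \<rho> x (x + h *\<^sub>R (a *\<^sub>R v)) / \<bar>h\<bar>) \<longlongrightarrow> \<bar>a\<bar> * m v) (at 0)"
    using False by (simp add: abs_mult)
  then show ?thesis using derivative[of "a *\<^sub>R v"] LIM_unique by blast
qed

text \<open>
Convergence along each ray becomes uniform by comparing with finitely many directions that form a net in the
unit sphere.
\<close>

lemma derivative_uniform:
  assumes "0 < e"
  shows "\<exists>d>0. \<forall>y. dist x y < d \<longrightarrow> \<bar>\<rho> x y - m (y - x)\<bar> \<le> e * dist x y"
proof -
  define e' where "e' = e / (3 * (L + 1))"
  have e': "0 < e'" "L * e' \<le> e / 3"
    using assms L_nonneg by (auto simp: e'_def field_simps)
  obtain T :: "'v set" where T: "finite T" "sphere 0 1 \<subseteq> (\<Union>v\<in>T. ball v e')"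
    using compact_sphere[of "0::'v" 1, unfolded compact_eq_totally_bounded] e' by metis
  have "\<forall>\<^sub>F h in at 0. \<bar>\<rho> x (x + h *\<^sub>R v) / \<bar>h\<bar> - m v\<bar> < e / 3" for v
    using tendstoD[OF derivative, of "e / 3" v] assms by (simp add: dist_real_def)
  then have "\<forall>\<^sub>F h in at 0. \<forall>v\<in>T. \<bar>\<rho> x (x + h *\<^sub>R v) / \<bar>h\<bar> - m v\<bar> < e / 3"
    using T(1) by (simp add: eventually_ball_finite)
  then obtain d where d: "0 < d"
    "\<And>h v. h \<noteq> 0 \<Longrightarrow> \<bar>h\<bar> < d \<Longrightarrow> v \<in> T \<Longrightarrow> \<bar>\<rho> x (x + h *\<^sub>R v) / \<bar>h\<bar> - m v\<bar> < e / 3"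
    by (auto simp: eventually_at)
  have "\<bar>\<rho> x y - m (y - x)\<bar> \<le> e * dist x y" if y: "dist x y < d" for y
  proof (cases "y = x")
    case True
    then show ?thesis by (simp add: self_eq_0 derivative_zero)
  next
    case False
    define h w where "h = norm (y - x)" and "w = (1 / h) *\<^sub>R (y - x)"
    have h: "0 < h" "h < d" "dist x y = h"
      using False y by (auto simp: h_def dist_norm norm_minus_commute)
    have w: "w \<in> sphere 0 1" "y - x = h *\<^sub>R w" "y = x + h *\<^sub>R w"
      using h by (auto simp: w_def h_def)
    obtain v where v: "v \<in> T" "dist v w < e'" using T(2) w(1) by auto
    have "L * norm (w - v) \<le> L * e'"
      using v L_nonneg by (intro mult_left_mono) (auto simp: dist_norm norm_minus_commute)
    then have vw: "L * norm (w - v) \<le> e / 3" using e' by simp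
    have "\<bar>\<rho> x (x + h *\<^sub>R w) - \<rho> x (x + h *\<^sub>R v)\<bar> \<le> L * norm (w - v) * h"
      using quotient_lipschitz[of h w v] h by simp
    also have "\<dots> \<le> e / 3 * h"
      using vw h by (intro mult_right_mono) auto
    finally have "\<bar>\<rho> x (x + h *\<^sub>R w) - \<rho> x (x + h *\<^sub>R v)\<bar> \<le> e / 3 * h" .
    moreover have "\<bar>\<rho> x (x + h *\<^sub>R v) - h * m v\<bar> \<le> e / 3 * h"
    proof -
      have "\<rho> x (x + h *\<^sub>R v) - h * m v = (\<rho> x (x + h *\<^sub>R v) / \<bar>h\<bar> - m v) * h"
        using h by (simp add: field_simps)
      then have "\<bar>\<rho> x (x + h *\<^sub>R v) - h * m v\<bar> = \<bar>\<rho> x (x + h *\<^sub>R v) / \<bar>h\<bar> - m v\<bar> * h"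
        using h by (simp add: abs_mult)
      also have "\<dots> \<le> e / 3 * h"
        using d(2)[of h v] h v by (intro mult_right_mono) auto
      finally show ?thesis .
    qed
    moreover have "\<bar>h * m v - h * m w\<bar> \<le> e / 3 * h"
    proof -
      have "\<bar>h * m v - h * m w\<bar> = h * \<bar>m v - m w\<bar>"
        using h by (simp add: abs_mult right_diff_distrib[symmetric])
      also have "\<dots> \<le> h * (e / 3)"
        using derivative_lipschitz[of v w] vw h
        by (intro mult_left_mono) (auto simp: norm_minus_commute)
      finally show ?thesis by (simp add: mult.commute)
    qed
    ultimately have "\<bar>\<rho> x (x + h *\<^sub>R w) - h * m w\<bar> \<le> e * h" by linarith
    then show ?thesis
      unfolding h(3) using w derivative_homogeneous[of h w] h by simp
  qed
  with d(1) show ?thesis by blast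
qed

text \<open>
Split \<open>\<rho> x (x + h *\<^sub>R (u + v))\<close> at \<open>y = x + h *\<^sub>R u\<close>. The first part has derivative \<open>m u\<close>. The second part
starts at \<open>y\<close> and not at \<open>x\<close>; the set \<open>E\<close> provides a nearby starting point at which the quotients in
direction \<open>v\<close> are still at most \<open>q\<close>, for any \<open>q\<close> just above \<open>m v\<close>.
\<close>

lemma derivative_subadditive_if_not_porous:
  assumes q: "\<And>q. m v < q \<Longrightarrow> q \<in> \<rat> \<Longrightarrow>
      \<exists>E. (\<exists>d>0. \<forall>z\<in>E. \<forall>h. \<bar>h\<bar> < d \<longrightarrow> \<rho> z (z + h *\<^sub>R v) \<le> q * \<bar>h\<bar>) \<and>
        (\<forall>\<eta>>0. \<exists>d>0. \<forall>y. 0 < dist x y \<and> dist x y < d \<longrightarrow> E \<inter> ball y (\<eta> * dist x y) \<noteq> {})"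
  shows "m (u + v) \<le> m u + m v"
proof (cases "u = 0")
  case True
  then show ?thesis by (simp add: derivative_zero)
next
  case False
  show ?thesis
  proof (rule field_le_epsilon)
    fix e :: real assume "0 < e"
    obtain q where q1: "q \<in> \<rat>" "m v < q" "q < m v + e / 2"
      using Rats_dense_in_real[of "m v" "m v + e / 2"] \<open>0 < e\<close> by auto
    from q[OF q1(2,1)] obtain E d where E: "0 < d"
      "\<And>z h. z \<in> E \<Longrightarrow> \<bar>h\<bar> < d \<Longrightarrow> \<rho> z (z + h *\<^sub>R v) \<le> q * \<bar>h\<bar>"
      "\<And>\<eta>. \<eta> > 0 \<Longrightarrow> \<exists>d>0. \<forall>y. 0 < dist x y \<and> dist x y < d \<longrightarrow> E \<inter> ball y (\<eta> * dist x y) \<noteq> {}"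
      by blast
    \<comment> \<open>Replacing \<open>y\<close> by a point of \<open>E\<close> within \<open>\<eta> * dist x y\<close> costs at most \<open>e / 2 * \<bar>h\<bar>\<close>.\<close>
    define \<eta> where "\<eta> = e / (4 * (L + 1) * norm u)"
    have "\<eta> * norm u = e / (4 * (L + 1))" using False by (simp add: \<eta>_def)
    moreover have "2 * L * (e / (4 * (L + 1))) \<le> e / 2"
      using \<open>0 < e\<close> L_nonneg by (simp add: field_simps)
    ultimately have \<eta>: "0 < \<eta>" "2 * L * (\<eta> * norm u) \<le> e / 2"
      using \<open>0 < e\<close> False L_nonneg by (simp_all add: \<eta>_def)
    obtain d' where d': "0 < d'"
      "\<And>y. 0 < dist x y \<Longrightarrow> dist x y < d' \<Longrightarrow> E \<inter> ball y (\<eta> * dist x y) \<noteq> {}"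
      using E(3)[OF \<eta>(1)] by blast
    have bound: "\<rho> x (x + h *\<^sub>R (u + v)) / \<bar>h\<bar> \<le> \<rho> x (x + h *\<^sub>R u) / \<bar>h\<bar> + (m v + e)"
      if h: "h \<noteq> 0" "\<bar>h\<bar> < d" "\<bar>h\<bar> < d' / norm u" for h
    proof -
      define y where "y = x + h *\<^sub>R u"
      have xy: "dist x y = \<bar>h\<bar> * norm u" by (simp add: y_def dist_norm)
      have "0 < dist x y" "dist x y < d'" using h False by (auto simp: xy field_simps)
      from d'(2)[OF this] obtain z where z: "z \<in> E" "dist y z < \<eta> * dist x y" by auto
      have "\<rho> y (y + h *\<^sub>R v) \<le> \<rho> z (z + h *\<^sub>R v) + 2 * L * dist y z"
        using diff_le[of y "y + h *\<^sub>R v" z "z + h *\<^sub>R v"] by auto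
      also have "2 * L * dist y z \<le> 2 * L * (\<eta> * dist x y)"
        using z L_nonneg by (intro mult_left_mono) auto
      also have "\<dots> = (2 * L * (\<eta> * norm u)) * \<bar>h\<bar>" by (simp add: xy)
      also have "\<dots> \<le> e / 2 * \<bar>h\<bar>" using \<eta>(2) by (rule mult_right_mono) simp
      also have "\<rho> z (z + h *\<^sub>R v) \<le> q * \<bar>h\<bar>" using E(2) z h by blast
      also have "q * \<bar>h\<bar> \<le> (m v + e / 2) * \<bar>h\<bar>" using q1 by (intro mult_right_mono) auto
      finally have "\<rho> y (y + h *\<^sub>R v) \<le> (m v + e) * \<bar>h\<bar>" by (simp add: algebra_simps)
      then have "\<rho> x (x + h *\<^sub>R (u + v)) \<le> \<rho> x (x + h *\<^sub>R u) + (m v + e) * \<bar>h\<bar>"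
        using triangle[of x "y + h *\<^sub>R v" y] by (simp add: y_def algebra_simps)
      with h show ?thesis by (simp add: field_simps)
    qed
    have "m (u + v) \<le> m u + (m v + e)"
    proof (rule tendsto_le)
      show "((\<lambda>h. \<rho> x (x + h *\<^sub>R u) / \<bar>h\<bar> + (m v + e)) \<longlongrightarrow> m u + (m v + e)) (at 0)"
        by (intro tendsto_intros derivative)
      show "\<forall>\<^sub>F h in at 0. \<rho> x (x + h *\<^sub>R (u + v)) / \<bar>h\<bar> \<le> \<rho> x (x + h *\<^sub>R u) / \<bar>h\<bar> + (m v + e)"
        unfolding eventually_at using bound E(1) d'(1) False
        by (intro exI[of _ "min d (d' / norm u)"]) auto
    qed (use derivative in auto)
    then show "m (u + v) \<le> m u + m v + e" by simp
  qed
qed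

end

text \<open>
Metric differentiability for pseudometrics, after Kirchheim. The exceptional set collects the points
without directional derivatives and the porosity points of countably many sets \<open>E v q k\<close>, with
\<open>v\<close> in a dense set of directions and \<open>q\<close> rational; the Lipschitz bound on \<open>m\<close> extends subadditivity to all \<open>v\<close>.
\<close>

theorem ae_metric_derivative_of_pseudometric:
  fixes \<rho> :: "'v::euclidean_space \<Rightarrow> 'v \<Rightarrow> real"
  assumes "lipschitz_pseudometric \<rho> L"
  obtains N where "negligible N"
    "\<And>x. x \<notin> N \<Longrightarrow> \<exists>m. is_seminorm m \<and> (\<forall>v w. \<bar>m v - m w\<bar> \<le> L * norm (v - w)) \<and>
      (\<forall>e>0. \<exists>d>0. \<forall>y. dist x y < d \<longrightarrow> \<bar>\<rho> x y - m (y - x)\<bar> \<le> e * dist x y)"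
proof -
  interpret lipschitz_pseudometric \<rho> L by fact
  obtain D :: "'v set" where D: "countable D" "\<And>X. open X \<Longrightarrow> X \<noteq> {} \<Longrightarrow> \<exists>d\<in>D. d \<in> X"
    using countable_dense_exists by metis
  obtain N0 where N0: "negligible N0"
    "\<And>x. x \<notin> N0 \<Longrightarrow> \<exists>m. \<forall>v. ((\<lambda>h. \<rho> x (x + h *\<^sub>R v) / \<bar>h\<bar>) \<longlongrightarrow> m v) (at 0)"
    using ae_directional_derivatives[OF assms] by metis
  \<comment> \<open>Points at which \<open>q\<close> bounds the quotients in direction \<open>v\<close> at one common scale.\<close>
  define E where "E v q k = {z. \<forall>h. \<bar>h\<bar> < 1 / real (Suc k) \<longrightarrow> \<rho> z (z + h *\<^sub>R v) \<le> q * \<bar>h\<bar>}"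
    for v and q :: real and k
  define R where "R v q k = {x \<in> E v q k. \<exists>\<eta>>0. \<forall>d>0. \<exists>y. 0 < dist x y \<and> dist x y < d \<and>
    E v q k \<inter> ball y (\<eta> * dist x y) = {}}" for v and q :: real and k
  define N where "N = N0 \<union> (\<Union>(v, q, k) \<in> D \<times> \<rat> \<times> UNIV. R v q k)"
  show thesis
  proof
    have "countable (D \<times> (\<rat>::real set) \<times> (UNIV::nat set))"
      using D(1) countable_rat by (intro countable_SIGMA) auto
    then have "negligible (\<Union>(v, q, k) \<in> D \<times> \<rat> \<times> UNIV. R v q k)"
      unfolding R_def using negligible_porous_points by (intro negligible_countable_Union) auto
    then show "negligible N" using N0(1) by (simp add: N_def)
    fix x assume x: "x \<notin> N"
    then have "x \<notin> N0" by (simp add: N_def)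
    then obtain m where m: "\<And>v. ((\<lambda>h. \<rho> x (x + h *\<^sub>R v) / \<bar>h\<bar>) \<longlongrightarrow> m v) (at 0)"
      using N0(2) by blast
    note lip = derivative_lipschitz[OF assms m]
    have dense_subadditive: "m (u + v) \<le> m u + m v" if "v \<in> D" for u v
    proof (rule derivative_subadditive_if_not_porous[OF assms m])
      fix q :: real assume q: "m v < q" "q \<in> \<rat>"
      have "\<forall>\<^sub>F h in at 0. \<rho> x (x + h *\<^sub>R v) / \<bar>h\<bar> < q"
        using order_tendstoD(2)[OF m q(1)] .
      then obtain d where d: "0 < d" "\<And>h. h \<noteq> 0 \<Longrightarrow> \<bar>h\<bar> < d \<Longrightarrow> \<rho> x (x + h *\<^sub>R v) / \<bar>h\<bar> < q"
        by (auto simp: eventually_at)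
      obtain k where k: "1 / real (Suc k) < d" using d nat_approx_posE by metis
      have "\<rho> x (x + h *\<^sub>R v) \<le> q * \<bar>h\<bar>" if "\<bar>h\<bar> < 1 / real (Suc k)" for h
        using d(2)[of h] that k by (cases "h = 0") (auto simp: self_eq_0 field_simps)
      then have "x \<in> E v q k" by (simp add: E_def)
      moreover have "x \<notin> R v q k" using x q \<open>v \<in> D\<close> by (auto simp: N_def)
      ultimately have np: "\<forall>\<eta>>0. \<exists>d>0. \<forall>y. 0 < dist x y \<and> dist x y < d \<longrightarrow>
          E v q k \<inter> ball y (\<eta> * dist x y) \<noteq> {}"
        unfolding R_def by blast
      have small: "\<exists>d>0. \<forall>z\<in>E v q k. \<forall>h. \<bar>h\<bar> < d \<longrightarrow> \<rho> z (z + h *\<^sub>R v) \<le> q * \<bar>h\<bar>"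
        by (intro exI[of _ "1 / real (Suc k)"]) (simp add: E_def)
      show "\<exists>E. (\<exists>d>0. \<forall>z\<in>E. \<forall>h. \<bar>h\<bar> < d \<longrightarrow> \<rho> z (z + h *\<^sub>R v) \<le> q * \<bar>h\<bar>) \<and>
        (\<forall>\<eta>>0. \<exists>d>0. \<forall>y. 0 < dist x y \<and> dist x y < d \<longrightarrow> E \<inter> ball y (\<eta> * dist x y) \<noteq> {})"
        using small np by blast
    qed
    have "m (u + v) \<le> m u + m v" for u v
    proof (rule field_le_epsilon)
      fix e :: real assume "0 < e"
      then have "0 < e / (2 * (L + 1))" using L_nonneg by simp
      then obtain w where w: "w \<in> D" "w \<in> ball v (e / (2 * (L + 1)))"
        using D(2)[of "ball v (e / (2 * (L + 1)))"] by (metis open_ball centre_in_ball empty_iff)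
      have "L * norm (v - w) \<le> L * (e / (2 * (L + 1)))"
        using w L_nonneg by (intro mult_left_mono) (auto simp: dist_norm)
      also have "\<dots> \<le> e / 2" using L_nonneg \<open>0 < e\<close> by (simp add: field_simps)
      finally show "m (u + v) \<le> m u + m v + e"
        using lip[of "u + v" "u + w"] lip[of v w] dense_subadditive[OF w(1), of u]
        unfolding add_diff_cancel_left by linarith
    qed
    then have "is_seminorm m"
      using derivative_homogeneous[OF assms m] by (simp add: is_seminorm_def)
    then show "\<exists>m. is_seminorm m \<and> (\<forall>v w. \<bar>m v - m w\<bar> \<le> L * norm (v - w)) \<and>
      (\<forall>e>0. \<exists>d>0. \<forall>y. dist x y < d \<longrightarrow> \<bar>\<rho> x y - m (y - x)\<bar> \<le> e * dist x y)"
      using lip derivative_uniform[OF assms m] by blast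
  qed
qed

section \<open>Lipschitz maps on subsets\<close>

text \<open>
The largest pseudometric of the form \<open>sup \<bar>h x - h y\<bar>\<close>, over \<open>L\<close>-Lipschitz functions \<open>h\<close> that are
1-Lipschitz on \<open>A\<close> for the distances of the values of \<open>g\<close>, is defined on the whole space. Extending the
distances in this way replaces an extension of \<open>g\<close> itself, which a general target does not admit.
\<close>

lemma lipschitz_map_induces_pseudometric:
  fixes g :: "'v::metric_space \<Rightarrow> 'b::metric_space"
  assumes g: "L-lipschitz_on A g"
  obtains \<rho> where "lipschitz_pseudometric \<rho> L" "\<And>a b. a \<in> A \<Longrightarrow> b \<in> A \<Longrightarrow> \<rho> a b = dist (g a) (g b)"
proof -
  have L: "0 \<le> L" using g by (rule lipschitz_on_nonneg)
  define H where "H = {h :: 'v \<Rightarrow> real. (\<forall>x y. \<bar>h x - h y\<bar> \<le> L * dist x y) \<and>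
    (\<forall>a\<in>A. \<forall>b\<in>A. \<bar>h a - h b\<bar> \<le> dist (g a) (g b))}"
  define \<rho> where "\<rho> x y = (SUP h\<in>H. \<bar>h x - h y\<bar>)" for x y
  have "(\<lambda>_. 0) \<in> H" using L by (simp add: H_def)
  then have ne: "H \<noteq> {}" by auto
  have bdd: "bdd_above ((\<lambda>h. \<bar>h x - h y\<bar>) ` H)" for x y
    by (rule bdd_aboveI[of _ "L * dist x y"]) (auto simp: H_def)
  have upper: "\<bar>h x - h y\<bar> \<le> \<rho> x y" if "h \<in> H" for h x y
    unfolding \<rho>_def using that by (intro cSUP_upper bdd)
  have least: "\<rho> x y \<le> B" if "\<And>h. h \<in> H \<Longrightarrow> \<bar>h x - h y\<bar> \<le> B" for x y B
    unfolding \<rho>_def using ne that by (intro cSUP_least)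
  show thesis
  proof
    show "lipschitz_pseudometric \<rho> L"
    proof
      fix x y z
      show "\<rho> x y = \<rho> y x" by (simp add: \<rho>_def abs_minus_commute)
      show "0 \<le> \<rho> x y" using upper[OF \<open>(\<lambda>_. 0) \<in> H\<close>, of x y] by simp
      show "\<rho> x y \<le> L * dist x y" by (rule least) (simp add: H_def)
      show "\<rho> x z \<le> \<rho> x y + \<rho> y z"
      proof (rule least)
        fix h assume "h \<in> H"
        then show "\<bar>h x - h z\<bar> \<le> \<rho> x y + \<rho> y z" using upper[of h x y] upper[of h y z] by linarith
      qed
    qed (rule L)
    fix a b assume ab: "a \<in> A" "b \<in> A"
    \<comment> \<open>McShane's extension of \<open>\<lambda>c. dist (g a) (g c)\<close> from \<open>A\<close> attains the supremum at pairs \<open>(a, b)\<close>.\<close>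
    define k where "k x = (INF c\<in>A. dist (g a) (g c) + L * dist c x)" for x
    have lower: "k x \<le> dist (g a) (g c) + L * dist c x" if "c \<in> A" for c x
      unfolding k_def using that L by (intro cINF_lower bdd_belowI[of _ 0]) auto
    have greatest: "B \<le> k x" if "\<And>c. c \<in> A \<Longrightarrow> B \<le> dist (g a) (g c) + L * dist c x" for B x
      unfolding k_def using ab that by (intro cINF_greatest) auto
    have k_eq: "k c = dist (g a) (g c)" if "c \<in> A" for c
    proof (rule antisym)
      show "k c \<le> dist (g a) (g c)" using lower[OF that, of c] by simp
      show "dist (g a) (g c) \<le> k c"
      proof (rule greatest)
        fix c' assume "c' \<in> A"
        then have "dist (g c') (g c) \<le> L * dist c' c" using lipschitz_onD[OF g] that by blast
        then show "dist (g a) (g c) \<le> dist (g a) (g c') + L * dist c' c"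
          using dist_triangle[of "g a" "g c" "g c'"] by linarith
      qed
    qed
    have k_le: "k x \<le> k y + L * dist x y" for x y
    proof -
      have "k x - L * dist x y \<le> k y"
      proof (rule greatest)
        fix c assume "c \<in> A"
        have "L * dist c x \<le> L * (dist c y + dist x y)"
          using L dist_triangle[of c x y] by (intro mult_left_mono) (simp_all add: dist_commute)
        then show "k x - L * dist x y \<le> dist (g a) (g c) + L * dist c y"
          using lower[OF \<open>c \<in> A\<close>, of x] by (simp add: distrib_left)
      qed
      then show ?thesis by simp
    qed
    have "k \<in> H"
      unfolding H_def
    proof (safe)
      fix x y show "\<bar>k x - k y\<bar> \<le> L * dist x y"
        using k_le[of x y] k_le[of y x] by (simp add: dist_commute abs_le_iff)
    next
      fix b c assume "b \<in> A" "c \<in> A"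
      then show "\<bar>k b - k c\<bar> \<le> dist (g b) (g c)"
        using k_eq abs_dist_diff_le[of "g b" "g a" "g c"] by (simp add: dist_commute)
    qed
    from upper[OF this, of a b] have "dist (g a) (g b) \<le> \<rho> a b" using ab by (simp add: k_eq)
    moreover have "\<rho> a b \<le> dist (g a) (g b)" using ab by (intro least) (simp add: H_def)
    ultimately show "\<rho> a b = dist (g a) (g b)" by simp
  qed
qed

section \<open>From Euclidean space to the metric measure space\<close>

lemma near_points_if_not_porous_at:
  assumes "\<not> porous_at \<eta> A x" "x \<in> A"
  shows "\<exists>d>0. \<forall>y. y \<noteq> x \<longrightarrow> dist x y < d \<longrightarrow> (\<exists>a\<in>A. dist y a < \<eta> * dist x y)"
proof (rule ccontr)
  assume contra: "\<not> ?thesis"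
  have "\<exists>y. y \<noteq> x \<and> dist x y < 1 / real (Suc j) \<and> infdist y A \<ge> \<eta> * dist y x" for j
  proof -
    have "0 < 1 / real (Suc j)" by simp
    with contra obtain y where y: "y \<noteq> x" "dist x y < 1 / real (Suc j)"
      "\<And>a. a \<in> A \<Longrightarrow> \<eta> * dist x y \<le> dist y a"
      by (meson not_less)
    have "\<eta> * dist x y \<le> infdist y A"
      using y(3) \<open>x \<in> A\<close> by (auto simp: infdist_def intro!: cINF_greatest)
    with y show ?thesis by (auto simp: dist_commute)
  qed
  then obtain X where X: "\<And>j. X j \<noteq> x" "\<And>j. dist x (X j) < 1 / real (Suc j)"
    "\<And>j. infdist (X j) A \<ge> \<eta> * dist (X j) x"
    by metis
  have "X \<longlonglongrightarrow> x"
  proof (rule metric_tendsto_imp_tendsto[OF LIMSEQ_inverse_real_of_nat])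
    show "\<forall>\<^sub>F j in sequentially. dist (X j) x \<le> dist (inverse (real (Suc j))) 0"
      using X(2) by (intro always_eventually) (simp add: dist_commute inverse_eq_divide less_imp_le)
  qed
  with X \<open>x \<in> A\<close> assms(1) show False unfolding porous_at_def by blast
qed

lemma Limsup_eq_0_if_eventually_le:
  fixes q :: "'i \<Rightarrow> real"
  assumes "\<And>e. 0 < e \<Longrightarrow> \<forall>\<^sub>F y in F. q y \<le> e"
  shows "Limsup F (\<lambda>y. ennreal (q y)) = 0"
proof -
  have "Limsup F (\<lambda>y. ennreal (q y)) \<le> 0"
  proof (rule ennreal_le_epsilon)
    fix e :: real assume "0 < e"
    then have "Limsup F (\<lambda>y. ennreal (q y)) \<le> ennreal e"
      using assms by (intro Limsup_bounded) (auto elim!: eventually_mono intro: ennreal_leI)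
    then show "Limsup F (\<lambda>y. ennreal (q y)) \<le> 0 + ennreal e" by simp
  qed
  then show ?thesis by simp
qed

lemma Lipschitz_estimate_on_ball_if_pointwise_Lip:
  fixes f :: "'a::metric_space \<Rightarrow> 'b::metric_space"
  assumes "x \<in> pointwise_Lip_set f"
  shows "\<exists>k. \<forall>y. dist x y < 1 / real (Suc k) \<longrightarrow> dist (f x) (f y) \<le> real (Suc k) * dist x y"
proof -
  have "\<exists>M. \<forall>\<^sub>F y in at x. dist (f x) (f y) / dist x y < M"
  proof (cases "x islimpt UNIV")
    case True
    have "Limsup (at x) (\<lambda>y. ennreal (dist (f x) (f y) / dist x y)) < top"
      using assms True by (simp add: pointwise_Lip_set_def Lip_def)
    then obtain M' where M': "Limsup (at x) (\<lambda>y. ennreal (dist (f x) (f y) / dist x y)) < M'" "M' < top"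
      using dense by blast
    then obtain M where M: "M' = ennreal M" "0 \<le> M" by (cases M') auto
    from Limsup_lessD[OF M'(1)] have "\<forall>\<^sub>F y in at x. dist (f x) (f y) / dist x y < M"
      by (rule eventually_mono) (simp add: M ennreal_less_iff)
    then show ?thesis ..
  next
    case False
    then have "at x = bot" by (simp add: islimpt_conv_frequently_at trivial_limit_within)
    then show ?thesis by simp
  qed
  then obtain M d where d: "0 < d"
    "\<And>y. y \<noteq> x \<Longrightarrow> dist x y < d \<Longrightarrow> dist (f x) (f y) / dist x y < M"
    by (auto simp: eventually_at dist_commute)
  obtain i where i: "1 / real (Suc i) < d" using d(1) nat_approx_posE by metis
  obtain j where j: "M < real j" using reals_Archimedean2 by blast
  define k where "k = max i j"
  have "dist (f x) (f y) \<le> real (Suc k) * dist x y" if y: "dist x y < 1 / real (Suc k)" for y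
  proof (cases "y = x")
    case False
    have "1 / real (Suc k) \<le> 1 / real (Suc i)" by (intro divide_left_mono) (auto simp: k_def)
    with i y have "dist x y < d" by simp
    then have "dist (f x) (f y) / dist x y \<le> real (Suc k)"
      using d(2)[OF False] j by (force simp: k_def)
    with False show ?thesis by (simp add: field_simps)
  qed simp
  then show ?thesis by blast
qed

text \<open>
The metric derivative of \<open>f\<close> at \<open>x\<close> is that of the pseudometric induced by \<open>f\<close> in the chart, which only
sees points of \<open>A\<close>. For \<open>y\<close> outside \<open>A\<close>, a point \<open>a\<close> of \<open>A\<close> with \<open>dist y a < \<eta> * dist x y\<close> exists since
\<open>A\<close> is not \<open>\<eta>\<close>-porous at \<open>x\<close>. The values \<open>f y\<close> and \<open>f a\<close> are close because the estimate for \<open>f\<close> at \<open>a\<close> holds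
against all points of the space.
\<close>

lemma metrically_differentiable_on_lipschitz_piece:
  fixes f :: "'a::metric_space \<Rightarrow> 'b::metric_space" and \<phi> :: "'a \<Rightarrow> real ^ 'n"
  assumes "A \<subseteq> U" "0 < c" "0 < r" "0 \<le> K"
    and lower: "\<And>x y. x \<in> A \<Longrightarrow> y \<in> A \<Longrightarrow> c * dist x y \<le> dist (\<phi> x) (\<phi> y)"
    and upper: "C-lipschitz_on UNIV \<phi>"
    and f: "\<And>x y. x \<in> A \<Longrightarrow> dist x y < r \<Longrightarrow> dist (f x) (f y) \<le> K * dist x y"
    and small: "\<And>x y. x \<in> A \<Longrightarrow> y \<in> A \<Longrightarrow> dist x y < r"
  obtains N where "negligible N"
    "\<And>x. x \<in> A \<Longrightarrow> \<phi> x \<notin> N \<Longrightarrow> \<not> (\<exists>\<eta>>0. porous_at \<eta> A x) \<Longrightarrow>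
       metrically_differentiable_at U \<phi> f x"
proof -
  have C: "0 \<le> C" using upper by (rule lipschitz_on_nonneg)
  have \<phi>: "dist (\<phi> x) (\<phi> y) \<le> C * dist x y" for x y
    using lipschitz_onD[OF upper] by simp
  have inj: "inj_on \<phi> A"
  proof (rule inj_onI)
    fix x y assume "x \<in> A" "y \<in> A" "\<phi> x = \<phi> y"
    then have "c * dist x y \<le> 0" using lower[of x y] by simp
    then show "x = y" using \<open>0 < c\<close> by (simp add: mult_le_0_iff)
  qed
  define g where "g = f \<circ> inv_into A \<phi>"
  have g: "g (\<phi> x) = f x" if "x \<in> A" for x using that inj by (simp add: g_def)
  define L where "L = K / c"
  have L: "0 \<le> L" using \<open>0 < c\<close> \<open>0 \<le> K\<close> by (simp add: L_def)
  have "L-lipschitz_on (\<phi> ` A) g"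
  proof (rule lipschitz_onI[OF _ L], clarify)
    fix x y assume xy: "x \<in> A" "y \<in> A"
    have "dist (f x) (f y) \<le> K * dist x y" using f small xy by blast
    also have "\<dots> = L * (c * dist x y)" using \<open>0 < c\<close> by (simp add: L_def)
    also have "\<dots> \<le> L * dist (\<phi> x) (\<phi> y)" using lower[OF xy] L by (rule mult_left_mono)
    finally show "dist (g (\<phi> x)) (g (\<phi> y)) \<le> L * dist (\<phi> x) (\<phi> y)" using g xy by simp
  qed
  then obtain \<rho> where \<rho>: "lipschitz_pseudometric \<rho> L"
    "\<And>p q. p \<in> \<phi> ` A \<Longrightarrow> q \<in> \<phi> ` A \<Longrightarrow> \<rho> p q = dist (g p) (g q)"
    using lipschitz_map_induces_pseudometric by blast
  obtain N where N: "negligible N"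
    "\<And>p. p \<notin> N \<Longrightarrow> \<exists>m. is_seminorm m \<and> (\<forall>v w. \<bar>m v - m w\<bar> \<le> L * norm (v - w)) \<and>
      (\<forall>e>0. \<exists>d>0. \<forall>q. dist p q < d \<longrightarrow> \<bar>\<rho> p q - m (q - p)\<bar> \<le> e * dist p q)"
    using ae_metric_derivative_of_pseudometric[OF \<rho>(1)] by metis
  show thesis
  proof
    show "negligible N" by (rule N(1))
    fix x assume x: "x \<in> A" "\<phi> x \<notin> N" "\<not> (\<exists>\<eta>>0. porous_at \<eta> A x)"
    obtain m where m: "is_seminorm m" "\<And>v w. \<bar>m v - m w\<bar> \<le> L * norm (v - w)"
      "\<And>e. 0 < e \<Longrightarrow> \<exists>d>0. \<forall>q. dist (\<phi> x) q < d \<longrightarrow> \<bar>\<rho> (\<phi> x) q - m (q - \<phi> x)\<bar> \<le> e * dist (\<phi> x) q"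
      using N(2)[OF x(2)] by blast
    have even: "m (- v) = m v" for v
    proof -
      have "m ((-1) *\<^sub>R v) = \<bar>-1\<bar> * m v" using m(1) unfolding is_seminorm_def by blast
      then show ?thesis by simp
    qed
    have "Limsup (at x) (\<lambda>y. ennreal (\<bar>dist (f x) (f y) - m (\<phi> x - \<phi> y)\<bar> / dist x y)) = 0"
    proof (rule Limsup_eq_0_if_eventually_le)
      fix e :: real assume e: "0 < e"
      \<comment> \<open>The error has two parts of at most \<open>e / 2\<close> each: \<open>e'\<close> is the accuracy of the derivative at
        \<open>\<phi> a\<close>, and \<open>\<eta>\<close> is the relative distance from \<open>y\<close> to the nearby point \<open>a\<close> of \<open>A\<close>.\<close>
      define \<eta> where "\<eta> = min 1 (e / (2 * (K + L * C + 1)))"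
      define e' where "e' = e / (4 * (C + 1))"
      have LC: "0 \<le> L * C" using L C by simp
      have \<eta>: "0 < \<eta>" "\<eta> \<le> 1" using e \<open>0 \<le> K\<close> LC by (auto simp: \<eta>_def)
      have "(K + L * C) * \<eta> \<le> (K + L * C) * (e / (2 * (K + L * C + 1)))"
        using \<open>0 \<le> K\<close> LC by (intro mult_left_mono) (auto simp: \<eta>_def)
      also have "\<dots> \<le> e / 2" using \<open>0 \<le> K\<close> LC e by (simp add: field_simps)
      finally have \<eta>2: "(K + L * C) * \<eta> \<le> e / 2" .
      have e': "0 < e'" using e C by (simp add: e'_def)
      have "e' * (2 * C) = e * C / (2 * (C + 1))" using C by (simp add: e'_def field_simps)
      also have "\<dots> \<le> e / 2" using C e by (simp add: field_simps)
      finally have e'2: "e' * (2 * C) \<le> e / 2" .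
      obtain d1 where d1: "0 < d1"
        "\<And>q. dist (\<phi> x) q < d1 \<Longrightarrow> \<bar>\<rho> (\<phi> x) q - m (q - \<phi> x)\<bar> \<le> e' * dist (\<phi> x) q"
        using m(3)[OF e'] by blast
      have "\<not> porous_at \<eta> A x" using x(3) \<eta>(1) by blast
      from near_points_if_not_porous_at[OF this x(1)] obtain d2 where d2: "0 < d2"
        "\<And>y. y \<noteq> x \<Longrightarrow> dist x y < d2 \<Longrightarrow> \<exists>a\<in>A. dist y a < \<eta> * dist x y"
        by blast
      define d where "d = min (min d2 r) (d1 / (2 * (C + 1)))"
      have "0 < d" using d1(1) d2(1) \<open>0 < r\<close> C by (simp add: d_def)
      have "\<bar>dist (f x) (f y) - m (\<phi> x - \<phi> y)\<bar> / dist x y \<le> e" if y: "y \<noteq> x" "dist x y < d" for y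
      proof -
        let ?t = "dist x y"
        have t: "0 < ?t" using y(1) by simp
        obtain a where a: "a \<in> A" "dist y a < \<eta> * ?t" using d2(2)[OF y(1)] y(2) by (auto simp: d_def)
        have ya: "dist y a < ?t" using a(2) mult_right_mono[OF \<eta>(2), of ?t] by simp
        then have xa: "dist x a \<le> 2 * ?t" using dist_triangle[of x a y] by simp
        have \<phi>xa: "dist (\<phi> x) (\<phi> a) \<le> C * (2 * ?t)"
          using \<phi>[of x a] mult_left_mono[OF xa C] by linarith
        also have "C * (2 * ?t) \<le> 2 * (C + 1) * ?t" by (simp add: algebra_simps)
        also have "\<dots> < d1" using y(2) C by (simp add: d_def field_simps)
        finally have "\<bar>\<rho> (\<phi> x) (\<phi> a) - m (\<phi> a - \<phi> x)\<bar> \<le> e' * dist (\<phi> x) (\<phi> a)"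
          by (rule d1(2))
        also have "\<dots> \<le> e' * (C * (2 * ?t))" using \<phi>xa e' by (intro mult_left_mono) auto
        also have "\<dots> = e' * (2 * C) * ?t" by simp
        also have "\<dots> \<le> e / 2 * ?t" using e'2 by (rule mult_right_mono) simp
        also have "\<rho> (\<phi> x) (\<phi> a) = dist (f x) (f a)" using \<rho>(2) x(1) a(1) g by simp
        finally have 1: "\<bar>dist (f x) (f a) - m (\<phi> a - \<phi> x)\<bar> \<le> e / 2 * ?t" .
        have "dist (f a) (f y) \<le> K * dist a y"
          using f a(1) ya y(2) by (simp add: d_def dist_commute)
        also have "\<dots> \<le> K * (\<eta> * ?t)"
          using a(2) \<open>0 \<le> K\<close> by (intro mult_left_mono) (auto simp: dist_commute)
        finally have 2: "\<bar>dist (f x) (f y) - dist (f x) (f a)\<bar> \<le> K * (\<eta> * ?t)"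
          using abs_dist_diff_le[of "f y" "f x" "f a"] by (simp add: dist_commute)
        have "\<bar>m (\<phi> a - \<phi> x) - m (\<phi> y - \<phi> x)\<bar> \<le> L * dist (\<phi> y) (\<phi> a)"
          using m(2)[of "\<phi> a - \<phi> x" "\<phi> y - \<phi> x"] by (simp add: dist_norm norm_minus_commute)
        also have "\<dots> \<le> L * (C * dist y a)" using \<phi> L by (rule mult_left_mono)
        also have "\<dots> \<le> L * (C * (\<eta> * ?t))" using a(2) L C by (intro mult_left_mono) auto
        finally have 3: "\<bar>m (\<phi> a - \<phi> x) - m (\<phi> x - \<phi> y)\<bar> \<le> L * (C * (\<eta> * ?t))"
          using even[of "\<phi> x - \<phi> y"] by simp
        have "\<bar>p - s\<bar> \<le> \<bar>p - q\<bar> + \<bar>q - r\<bar> + \<bar>r - s\<bar>" for p q r s :: real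
          by linarith
        from order_trans[OF this add_mono[OF add_mono[OF 2 1] 3]]
        have "\<bar>dist (f x) (f y) - m (\<phi> x - \<phi> y)\<bar> \<le> K * (\<eta> * ?t) + e / 2 * ?t + L * (C * (\<eta> * ?t))" .
        also have "\<dots> = e / 2 * ?t + (K + L * C) * \<eta> * ?t"
          by (simp add: algebra_simps)
        also have "\<dots> \<le> e / 2 * ?t + e / 2 * ?t"
          using \<eta>2 by (intro add_left_mono mult_right_mono) auto
        finally show ?thesis using t by (simp add: field_simps)
      qed
      with \<open>0 < d\<close> show "\<forall>\<^sub>F y in at x. \<bar>dist (f x) (f y) - m (\<phi> x - \<phi> y)\<bar> / dist x y \<le> e"
        by (auto simp: eventually_at dist_commute)
    qed
    with m(1) x(1) \<open>A \<subseteq> U\<close> show "metrically_differentiable_at U \<phi> f x"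
      by (auto simp: metrically_differentiable_at_def)
  qed
qed

lemma metric_measure_null_if_covered:
  assumes \<mu>: "metric_measure \<mu>" and "countable I"
    and cover: "B \<subseteq> (\<Union>i\<in>I. X i)" and null: "\<And>i. i \<in> I \<Longrightarrow> \<mu> (X i) = 0"
  shows "\<mu> B = 0"
proof (cases "I = {}")
  case True
  with cover have "B = {}" by simp
  with \<mu> show ?thesis by (simp add: metric_measure_def outer_measure_space_def positive_def)
next
  case False
  define Y where "Y n = X (from_nat_into I n)" for n
  have mono: "\<mu> S \<le> \<mu> T" if "S \<subseteq> T" for S T
    using \<mu> that by (auto simp: metric_measure_def outer_measure_space_def increasing_def)
  have Y: "\<mu> (Y n) = 0" for n
    using null from_nat_into[OF False] by (simp add: Y_def)
  have "\<mu> (disjointed Y n) = 0" for n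
    using mono[OF disjointed_subset[of Y n]] Y[of n] by simp
  have "B \<subseteq> (\<Union>n. disjointed Y n)"
    using cover UN_from_nat_into[OF \<open>countable I\<close> False, of X] by (simp add: UN_disjointed_eq Y_def)
  then have "\<mu> B \<le> \<mu> (\<Union>n. disjointed Y n)" by (rule mono)
  also have "\<dots> \<le> (\<Sum>n. \<mu> (disjointed Y n))"
    using \<mu> disjoint_family_disjointed[of Y]
    by (auto simp: metric_measure_def outer_measure_space_def countably_subadditive_def)
  also have "\<dots> = 0" using \<open>\<And>n. \<mu> (disjointed Y n) = 0\<close> by simp
  finally show ?thesis by simp
qed

lemma rectifiable_chart_null_preimage:
  assumes "rectifiable_chart \<mu> U \<phi>" "negligible N"
  shows "\<mu> (\<phi> -` N \<inter> U) = 0"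
proof -
  have "N \<in> null_sets lebesgue" using assms(2) by (simp add: negligible_iff_null_sets)
  then obtain N' where N': "N' \<in> null_sets lborel" "N \<subseteq> N'"
    by (auto simp: null_sets_completion_iff2)
  have "outer_measure_of lborel (N \<inter> \<phi> ` U) \<le> outer_measure_of lborel N'"
    using N'(2) by (intro outer_measure_of_mono) auto
  also have "\<dots> = 0" using N'(1) by (metis null_setsD1 null_setsD2 outer_measure_of_eq)
  finally have "restrict_outer (outer_measure_of lborel) (\<phi> ` U) N = 0"
    by (simp add: restrict_outer_def)
  then have "push_outer \<phi> (restrict_outer \<mu> U) N = 0"
    using assms(1) by (auto simp: rectifiable_chart_def abs_cont_outer_def)
  then show ?thesis by (simp add: push_outer_def restrict_outer_def)
qed

text \<open>
Passing to the subset of porosity points only increases the distance to the set, so the same holes witness porosity.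
\<close>

lemma porous_porous_points: "porous {x. \<exists>\<eta>>0. porous_at \<eta> A x}"
  unfolding porous_def
proof
  let ?P = "{x. \<exists>\<eta>>0. porous_at \<eta> A x}"
  fix x assume x: "x \<in> ?P"
  then obtain \<eta> X where \<eta>: "0 < \<eta>" "X \<longlonglongrightarrow> x"
    "\<And>j::nat. X j \<noteq> x \<and> infdist (X j) A \<ge> \<eta> * dist (X j) x"
    unfolding porous_at_def by blast
  have "?P \<subseteq> A" by (auto simp: porous_at_def)
  moreover have "?P \<noteq> {}" using x by blast
  ultimately have le: "infdist y A \<le> infdist y ?P" for y by (rule infdist_mono)
  have "porous_at \<eta> ?P x"
    unfolding porous_at_def[of \<eta> ?P x]
  proof (intro conjI exI[of _ X] allI x \<eta>(2))
    fix j show "X j \<noteq> x" "infdist (X j) ?P \<ge> \<eta> * dist (X j) x"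
      using \<eta>(3)[of j] le[of "X j"] by auto
  qed
  with \<eta>(1) show "\<exists>\<eta>>0. porous_at \<eta> ?P x" by blast
qed

theorem theorem1p2:
  fixes \<mu> :: "'a::polish_space set \<Rightarrow> ennreal"
    and U :: "'a set"
    and \<phi> :: "'a \<Rightarrow> real ^ 'n"
    and f :: "'a \<Rightarrow> 'b::metric_space"
  assumes "metric_measure \<mu>"
    and "\<And>S. porous S \<Longrightarrow> \<mu> S = 0"
    and "rectifiable_chart \<mu> U \<phi>"
  shows "\<mu> {x \<in> U \<inter> pointwise_Lip_set f. \<not> metrically_differentiable_at U \<phi> f x} = 0"
proof -
  obtain c where c: "0 < c" "\<And>x y. x \<in> U \<Longrightarrow> y \<in> U \<Longrightarrow> c * dist x y \<le> dist (\<phi> x) (\<phi> y)"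
    using assms(3) by (auto simp: rectifiable_chart_def bi_lipschitz_on_def)
  obtain C where C: "C-lipschitz_on UNIV \<phi>"
    using assms(3) by (auto simp: rectifiable_chart_def chart_def)
  obtain D :: "'a set" where D: "countable D" "\<And>X. open X \<Longrightarrow> X \<noteq> {} \<Longrightarrow> \<exists>d\<in>D. d \<in> X"
    using countable_dense_exists by metis
  \<comment> \<open>Countably many pieces, on each of which the Lipschitz estimate for \<open>f\<close> has one constant and holds up to a
    distance larger than that between any two points of the piece.\<close>
  define A where "A i = {x \<in> U \<inter> ball (snd i) (1 / (2 * real (Suc (fst i)))).
    \<forall>y. dist x y < 1 / real (Suc (fst i)) \<longrightarrow> dist (f x) (f y) \<le> real (Suc (fst i)) * dist x y}"
    for i :: "nat \<times> 'a"
  have "\<exists>N. negligible N \<and> (\<forall>x\<in>A i. \<phi> x \<notin> N \<longrightarrow> \<not> (\<exists>\<eta>>0. porous_at \<eta> (A i) x) \<longrightarrow>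
      metrically_differentiable_at U \<phi> f x)" for i
  proof -
    have small: "dist x y < 1 / real (Suc (fst i))" if "x \<in> A i" "y \<in> A i" for x y
    proof -
      define s where "s = 1 / (2 * real (Suc (fst i)))"
      have "dist (snd i) x < s" "dist (snd i) y < s" using that by (simp_all add: A_def s_def)
      then have "dist x y < s + s" using dist_triangle3[of x y "snd i"] by linarith
      also have "s + s = 1 / real (Suc (fst i))" by (simp add: s_def field_simps)
      finally show ?thesis .
    qed
    show ?thesis
    proof (rule metrically_differentiable_on_lipschitz_piece[of "A i" U c "1 / real (Suc (fst i))"
          "real (Suc (fst i))" \<phi> C f])
      show "A i \<subseteq> U" by (auto simp: A_def)
      show "c * dist x y \<le> dist (\<phi> x) (\<phi> y)" if "x \<in> A i" "y \<in> A i" for x y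
        using c(2) that by (simp add: A_def)
      show "dist (f x) (f y) \<le> real (Suc (fst i)) * dist x y"
        if "x \<in> A i" "dist x y < 1 / real (Suc (fst i))" for x y
        using that unfolding A_def by blast
    qed (use c(1) C small in auto)
  qed
  then obtain N where N: "\<And>i. negligible (N i)" "\<And>i x. x \<in> A i \<Longrightarrow> \<phi> x \<notin> N i \<Longrightarrow>
      \<not> (\<exists>\<eta>>0. porous_at \<eta> (A i) x) \<Longrightarrow> metrically_differentiable_at U \<phi> f x"
    by metis
  define X where "X i = (\<phi> -` N i \<inter> U) \<union> {x. \<exists>\<eta>>0. porous_at \<eta> (A i) x}" for i
  show ?thesis
  proof (rule metric_measure_null_if_covered[OF assms(1)])
    show "countable ((UNIV :: nat set) \<times> D)" using D(1) by auto
    show "\<mu> (X i) = 0" for i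
    proof (rule metric_measure_null_if_covered[OF assms(1), of UNIV _ "\<lambda>b::bool. if b then \<phi> -` N i \<inter> U else {x. \<exists>\<eta>>0. porous_at \<eta> (A i) x}"])
      show "\<mu> (if b then \<phi> -` N i \<inter> U else {x. \<exists>\<eta>>0. porous_at \<eta> (A i) x}) = 0" for b
        using rectifiable_chart_null_preimage[OF assms(3) N(1)] assms(2)[OF porous_porous_points]
        by simp
    qed (auto simp: X_def split: if_splits)
    show "{x \<in> U \<inter> pointwise_Lip_set f. \<not> metrically_differentiable_at U \<phi> f x} \<subseteq>
        (\<Union>i\<in>UNIV \<times> D. X i)"
    proof
      fix x assume x: "x \<in> {x \<in> U \<inter> pointwise_Lip_set f. \<not> metrically_differentiable_at U \<phi> f x}"
      then obtain k where k: "\<And>y. dist x y < 1 / real (Suc k) \<Longrightarrow> dist (f x) (f y) \<le> real (Suc k) * dist x y"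
        using Lipschitz_estimate_on_ball_if_pointwise_Lip by blast
      have "0 < 1 / (2 * real (Suc k))" by simp
      then obtain d where d: "d \<in> D" "d \<in> ball x (1 / (2 * real (Suc k)))"
        using D(2)[of "ball x (1 / (2 * real (Suc k)))"] by (metis open_ball centre_in_ball empty_iff)
      have "x \<in> A (k, d)" using x k d by (simp add: A_def dist_commute)
      with N(2)[of x "(k, d)"] x have "x \<in> X (k, d)" by (auto simp: X_def)
      with d(1) show "x \<in> (\<Union>i\<in>UNIV \<times> D. X i)" by blast
    qed
  qed
qed

end
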